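(* Suppose that $\nabla_a$ is a torsion-free connection in two dimensions and that $\epsilon^{bc}$ is a volume form (nowhere-vanishing skew bivector) such that $\nabla_a\epsilon^{bc}=0$. Define the Schouten tensor $\mathrm P_{ab}$ as in the context and $$Y_{abc}=\tfrac12(\nabla_a\mathrm P_{bc}-\nabla_b\mathrm P_{ac}),\qquad Y_c=\epsilon^{ab}\nabla_a\mathrm P_{bc},\qquad Z_{ab}=\nabla_{(a}Y_{b)}.$$ Let $$P_a=5Y_a,\quad Q_{ab}=12Z_{ab},\quad R_c=5Y_c,\quad S_{ca}=5\nabla_aY_c+2Z_{ac},$$ $$T_{cab}=5\nabla_{(a}\nabla_{b)}Y_c+4\nabla_{(a}Z_{b)c}-5\mathrm P_{ab}Y_c-15\mathrm P_{c(a}Y_{b)},$$ $$U_{cd}=Z_{cd},\qquad V_{cda}=\nabla_aZ_{cd}-5\mathrm P_{a(c}Y_{d)},$$ $$X_{cdab}=\nabla_{(a}\nabla_{b)}Z_{cd}-5(\nabla_{(a}\mathrm P_{b)(c})Y_{d)}-5\mathrm P_{c(a}\nabla_{b)}Y_d-5\mathrm P_{d(a}\nabla_{b)}Y_c-\mathrm P_{c(a}Z_{b)d}-\mathrm P_{d(a}Z_{b)c}+10Y_{(a}Y_{b)(cd)},$$ and define $$\mathcal D(\Gamma)=\epsilon^{ab}\epsilon^{cd}\epsilon^{ef}\epsilon^{gh}\epsilon^{ij}\epsilon^{kl}\epsilon^{mn}\epsilon^{pq}\Big[Q_{gi}S_{mp}T_{njk}U_{ac}V_{deq}X_{bfhl}-\tfrac16P_pR_mS_{nq}X_{acgi}X_{behk}X_{dfjl}-\tfrac12P_pS_{mq}T_{njl}U_{ce}X_{adgk}X_{bfhi}$$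 $$-\tfrac12P_pT_{mgi}T_{njk}U_{ac}V_{deq}X_{bfhl}+\tfrac12P_pR_mT_{ngi}V_{acq}X_{dejk}X_{bfhl}-\tfrac12Q_{gi}R_mS_{np}V_{acq}X_{dejk}X_{bfhl}$$ $$-\tfrac12Q_{gi}R_mT_{njk}V_{acp}V_{deq}X_{bfhl}-\tfrac14Q_{gi}S_{mp}S_{nq}U_{ac}X_{dejk}X_{bfhl}-\tfrac14Q_{gi}T_{mjk}T_{nhl}U_{ac}V_{dep}V_{bfq}\Big].$$ If $\nabla_a$ is projectively equivalent to a Levi-Civita connection, then $\mathcal D(\Gamma)=0$.
   Context: All objects live on a smooth two-dimensional manifold; indices are tensor indices with the summation convention; round brackets denote symmetrisation over the enclosed indices. The connection $\nabla$ has connection symbols $\Gamma^c_{ab}$, with $\nabla_aX^c=\partial_aX^c+\Gamma^c_{ab}X^b$. Its curvature is $[\nabla_a,\nabla_b]X^c=R_{abd}{}^cX^d$ and can be uniquely decomposed as $$R_{abd}{}^c=\delta_a^c\mathrm P_{bd}-\delta_b^c\mathrm P_{ad}+\beta_{ab}\delta^c_d$$ with $\beta_{ab}$ skew; this defines $\mathrm P_{ab}$ (under the hypothesis $\nabla_a\epsilon^{bc}=0$ one has $\beta_{ab}=0$ and $\mathrm P_{ab}=\mathrm P_{ba}$). Two torsion-free connections are projectively equivalent if $\hat\Gamma^c_{ab}=\Gamma^c_{ab}+\delta^c_a\omega_b+\delta^c_b\omega_a$ for some one-form $\omega_a$, equivalently they have the same unparametrised geodesics. Levi-Civita connections of metrics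 of any signature are allowed. *)

theory Defs
  imports "HOL-Analysis.Analysis"
begin

section \<open>Smooth functions on open subsets of the plane\<close>

type_synonym scalar = "real^2 \<Rightarrow> real"

definition partial :: "2 \<Rightarrow> scalar \<Rightarrow> scalar" where
  "partial a f x = frechet_derivative f (at x) (axis a 1)"

fun Ck_on :: "nat \<Rightarrow> (real^2) set \<Rightarrow> scalar \<Rightarrow> bool" where
  "Ck_on 0 S f \<longleftrightarrow> continuous_on S f"
| "Ck_on (Suc k) S f \<longleftrightarrow> (\<forall>x\<in>S. f differentiable (at x)) \<and> (\<forall>a. Ck_on k S (partial a f))"

definition smooth_on :: "(real^2) set \<Rightarrow> scalar \<Rightarrow> bool" where
  "smooth_on S f \<longleftrightarrow> (\<forall>k. Ck_on k S f)"


section \<open>Smooth surfaces\<close>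

type_synonym 'm chart = "'m set \<times> ('m \<Rightarrow> real^2)"

definition coords :: "'m chart \<Rightarrow> (real^2) set" where
  "coords \<kappa> = snd \<kappa> ` fst \<kappa>"

definition overlap :: "'m chart \<Rightarrow> 'm chart \<Rightarrow> (real^2) set" where
  "overlap \<kappa> \<mu> = snd \<kappa> ` (fst \<kappa> \<inter> fst \<mu>)"

definition transition :: "'m chart \<Rightarrow> 'm chart \<Rightarrow> real^2 \<Rightarrow> real^2" where
  "transition \<kappa> \<mu> x = snd \<mu> (inv_into (fst \<kappa>) (snd \<kappa>) x)"

definition smooth_surface :: "'m topology \<Rightarrow> 'm chart set \<Rightarrow> bool" where
  "smooth_surface M A \<longleftrightarrow>
     Hausdorff_space M \<and> second_countable M \<and> \<Union>(fst ` A) = topspace M \<and>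
     (\<forall>\<kappa>\<in>A. openin M (fst \<kappa>) \<and> open (coords \<kappa>) \<and>
        homeomorphic_map (subtopology M (fst \<kappa>)) (top_of_set (coords \<kappa>)) (snd \<kappa>)) \<and>
     (\<forall>\<kappa>\<in>A. \<forall>\<mu>\<in>A. \<forall>i. smooth_on (overlap \<kappa> \<mu>) (\<lambda>x. transition \<kappa> \<mu> x $ i))"

text \<open>With x and y the coordinates of \<open>\<kappa>\<close> and \<open>\<mu>\<close>:
  \<open>jac \<kappa> \<mu> b a\<close> is the partial derivative of \<open>y\<^sup>b\<close> with respect to \<open>x\<^sup>a\<close>, and
  \<open>hess \<kappa> \<mu> c a b\<close> the second partial derivative of \<open>y\<^sup>c\<close> with respect to \<open>x\<^sup>a\<close> and \<open>x\<^sup>b\<close>.\<close>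

definition jac :: "'m chart \<Rightarrow> 'm chart \<Rightarrow> 2 \<Rightarrow> 2 \<Rightarrow> scalar" where
  "jac \<kappa> \<mu> b a = partial a (\<lambda>x. transition \<kappa> \<mu> x $ b)"

definition hess :: "'m chart \<Rightarrow> 'm chart \<Rightarrow> 2 \<Rightarrow> 2 \<Rightarrow> 2 \<Rightarrow> scalar" where
  "hess \<kappa> \<mu> c a b = partial a (jac \<kappa> \<mu> c b)"


section \<open>Tensor fields and connections\<close>

text \<open>A tensor field or connection on a surface is the family of its component functions in the
  charts of the atlas, subject to the transformation law on overlaps. The values of a component
  function outside the coordinate domain of its chart are irrelevant.\<close>

type_synonym 'm tensor1 = "'m chart \<Rightarrow> 2 \<Rightarrow> scalar"
type_synonym 'm tensor2 = "'m chart \<Rightarrow> 2 \<Rightarrow> 2 \<Rightarrow> scalar"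
type_synonym 'm connection = "'m chart \<Rightarrow> 2 \<Rightarrow> 2 \<Rightarrow> 2 \<Rightarrow> scalar"

definition one_form :: "'m chart set \<Rightarrow> 'm tensor1 \<Rightarrow> bool" where
  "one_form A \<omega> \<longleftrightarrow>
     (\<forall>\<kappa>\<in>A. \<forall>a. smooth_on (coords \<kappa>) (\<omega> \<kappa> a)) \<and>
     (\<forall>\<kappa>\<in>A. \<forall>\<mu>\<in>A. \<forall>x\<in>overlap \<kappa> \<mu>. \<forall>a.
        \<omega> \<kappa> a x = (\<Sum>b\<in>UNIV. jac \<kappa> \<mu> b a x * \<omega> \<mu> b (transition \<kappa> \<mu> x)))"

definition covariant2 :: "'m chart set \<Rightarrow> 'm tensor2 \<Rightarrow> bool" where
  "covariant2 A g \<longleftrightarrow>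
     (\<forall>\<kappa>\<in>A. \<forall>a b. smooth_on (coords \<kappa>) (g \<kappa> a b)) \<and>
     (\<forall>\<kappa>\<in>A. \<forall>\<mu>\<in>A. \<forall>x\<in>overlap \<kappa> \<mu>. \<forall>a b.
        g \<kappa> a b x =
          (\<Sum>c\<in>UNIV. \<Sum>d\<in>UNIV. jac \<kappa> \<mu> c a x * jac \<kappa> \<mu> d b x * g \<mu> c d (transition \<kappa> \<mu> x)))"

definition contravariant2 :: "'m chart set \<Rightarrow> 'm tensor2 \<Rightarrow> bool" where
  "contravariant2 A \<epsilon> \<longleftrightarrow>
     (\<forall>\<kappa>\<in>A. \<forall>a b. smooth_on (coords \<kappa>) (\<epsilon> \<kappa> a b)) \<and>
     (\<forall>\<kappa>\<in>A. \<forall>\<mu>\<in>A. \<forall>x\<in>overlap \<kappa> \<mu>. \<forall>c d.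
        \<epsilon> \<mu> c d (transition \<kappa> \<mu> x) =
          (\<Sum>a\<in>UNIV. \<Sum>b\<in>UNIV. jac \<kappa> \<mu> c a x * jac \<kappa> \<mu> d b x * \<epsilon> \<kappa> a b x))"

text \<open>\<open>\<Gamma> \<kappa> c a b\<close> is the symbol with upper index c and lower indices a, b (in this order).\<close>

definition affine_connection :: "'m chart set \<Rightarrow> 'm connection \<Rightarrow> bool" where
  "affine_connection A \<Gamma> \<longleftrightarrow>
     (\<forall>\<kappa>\<in>A. \<forall>c a b. smooth_on (coords \<kappa>) (\<Gamma> \<kappa> c a b)) \<and>
     (\<forall>\<kappa>\<in>A. \<forall>\<mu>\<in>A. \<forall>x\<in>overlap \<kappa> \<mu>. \<forall>f a b.
        (\<Sum>c\<in>UNIV. jac \<kappa> \<mu> f c x * \<Gamma> \<kappa> c a b x) =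
          (\<Sum>d\<in>UNIV. \<Sum>e\<in>UNIV. jac \<kappa> \<mu> d a x * jac \<kappa> \<mu> e b x * \<Gamma> \<mu> f d e (transition \<kappa> \<mu> x))
          + hess \<kappa> \<mu> f a b x)"

definition torsion_free :: "'m chart set \<Rightarrow> 'm connection \<Rightarrow> bool" where
  "torsion_free A \<Gamma> \<longleftrightarrow> (\<forall>\<kappa>\<in>A. \<forall>x\<in>coords \<kappa>. \<forall>a b c. \<Gamma> \<kappa> c a b x = \<Gamma> \<kappa> c b a x)"

definition volume_bivector :: "'m chart set \<Rightarrow> 'm tensor2 \<Rightarrow> bool" where
  "volume_bivector A \<epsilon> \<longleftrightarrow> contravariant2 A \<epsilon> \<and>
     (\<forall>\<kappa>\<in>A. \<forall>x\<in>coords \<kappa>.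
        (\<forall>a b. \<epsilon> \<kappa> a b x = - \<epsilon> \<kappa> b a x) \<and> (\<exists>a b. \<epsilon> \<kappa> a b x \<noteq> 0))"

text \<open>Arbitrary signature is allowed.\<close>

definition pseudo_riemannian :: "'m chart set \<Rightarrow> 'm tensor2 \<Rightarrow> bool" where
  "pseudo_riemannian A g \<longleftrightarrow> covariant2 A g \<and>
     (\<forall>\<kappa>\<in>A. \<forall>x\<in>coords \<kappa>.
        (\<forall>a b. g \<kappa> a b x = g \<kappa> b a x) \<and> det (\<chi> a b. g \<kappa> a b x) \<noteq> 0)"


section \<open>Covariant derivatives in a chart\<close>

text \<open>The index of the derivative always comes first; e.g. \<open>cov_mixed \<Gamma> W a b c\<close> is the
  derivative in direction a of the component of W with lower index b and upper index c.\<close>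

context
  fixes \<Gamma> :: "2 \<Rightarrow> 2 \<Rightarrow> 2 \<Rightarrow> scalar"
begin

definition cov_vector :: "(2 \<Rightarrow> scalar) \<Rightarrow> 2 \<Rightarrow> 2 \<Rightarrow> scalar" where
  "cov_vector X a c x = partial a (X c) x + (\<Sum>b\<in>UNIV. \<Gamma> c a b x * X b x)"

definition cov_mixed :: "(2 \<Rightarrow> 2 \<Rightarrow> scalar) \<Rightarrow> 2 \<Rightarrow> 2 \<Rightarrow> 2 \<Rightarrow> scalar" where
  "cov_mixed W a b c x = partial a (W b c) x
     - (\<Sum>d\<in>UNIV. \<Gamma> d a b x * W d c x) + (\<Sum>d\<in>UNIV. \<Gamma> c a d x * W b d x)"

definition cov_bivector :: "(2 \<Rightarrow> 2 \<Rightarrow> scalar) \<Rightarrow> 2 \<Rightarrow> 2 \<Rightarrow> 2 \<Rightarrow> scalar" where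
  "cov_bivector E a b c x = partial a (E b c) x
     + (\<Sum>d\<in>UNIV. \<Gamma> b a d x * E d c x) + (\<Sum>d\<in>UNIV. \<Gamma> c a d x * E b d x)"

definition cov1 :: "(2 \<Rightarrow> scalar) \<Rightarrow> 2 \<Rightarrow> 2 \<Rightarrow> scalar" where
  "cov1 \<omega> a b x = partial a (\<omega> b) x - (\<Sum>e\<in>UNIV. \<Gamma> e a b x * \<omega> e x)"

definition cov2 :: "(2 \<Rightarrow> 2 \<Rightarrow> scalar) \<Rightarrow> 2 \<Rightarrow> 2 \<Rightarrow> 2 \<Rightarrow> scalar" where
  "cov2 \<omega> a b c x = partial a (\<omega> b c) x
     - (\<Sum>e\<in>UNIV. \<Gamma> e a b x * \<omega> e c x) - (\<Sum>e\<in>UNIV. \<Gamma> e a c x * \<omega> b e x)"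

definition cov3 :: "(2 \<Rightarrow> 2 \<Rightarrow> 2 \<Rightarrow> scalar) \<Rightarrow> 2 \<Rightarrow> 2 \<Rightarrow> 2 \<Rightarrow> 2 \<Rightarrow> scalar" where
  "cov3 \<omega> a b c d x = partial a (\<omega> b c d) x
     - (\<Sum>e\<in>UNIV. \<Gamma> e a b x * \<omega> e c d x) - (\<Sum>e\<in>UNIV. \<Gamma> e a c x * \<omega> b e d x)
     - (\<Sum>e\<in>UNIV. \<Gamma> e a d x * \<omega> b c e x)"

end


section \<open>Levi-Civita connections and projective equivalence\<close>

definition levi_civita :: "'m chart set \<Rightarrow> 'm tensor2 \<Rightarrow> 'm connection \<Rightarrow> bool" where
  "levi_civita A g \<Gamma> \<longleftrightarrow> affine_connection A \<Gamma> \<and> torsion_free A \<Gamma> \<and>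
     (\<forall>\<kappa>\<in>A. \<forall>x\<in>coords \<kappa>. \<forall>a b c. cov2 (\<Gamma> \<kappa>) (g \<kappa>) a b c x = 0)"

definition kdelta :: "2 \<Rightarrow> 2 \<Rightarrow> real" where
  "kdelta a b = (if a = b then 1 else 0)"

definition projectively_equivalent :: "'m chart set \<Rightarrow> 'm connection \<Rightarrow> 'm connection \<Rightarrow> bool" where
  "projectively_equivalent A \<Gamma> \<Gamma>' \<longleftrightarrow> (\<exists>\<omega>. one_form A \<omega> \<and>
     (\<forall>\<kappa>\<in>A. \<forall>x\<in>coords \<kappa>. \<forall>a b c.
        \<Gamma>' \<kappa> c a b x = \<Gamma> \<kappa> c a b x + kdelta c a * \<omega> \<kappa> b x + kdelta c b * \<omega> \<kappa> a x))"


section \<open>Curvature and Schouten tensor\<close>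

text \<open>\<open>R a b d c\<close> has lower indices a, b, d and upper index c. The torsion-free Ricci identity
  is required for all smooth vector fields X on the coordinate domain S.\<close>

definition curvature_on ::
  "(real^2) set \<Rightarrow> (2 \<Rightarrow> 2 \<Rightarrow> 2 \<Rightarrow> scalar) \<Rightarrow> (2 \<Rightarrow> 2 \<Rightarrow> 2 \<Rightarrow> 2 \<Rightarrow> scalar) \<Rightarrow> bool" where
  "curvature_on S \<Gamma> R \<longleftrightarrow>
     (\<forall>X. (\<forall>c. smooth_on S (X c)) \<longrightarrow>
        (\<forall>x\<in>S. \<forall>a b c.
           cov_mixed \<Gamma> (cov_vector \<Gamma> X) a b c x - cov_mixed \<Gamma> (cov_vector \<Gamma> X) b a c x
             = (\<Sum>d\<in>UNIV. R a b d c x * X d x)))"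

text \<open>In dimension two the decomposition with an arbitrary skew \<open>\<beta>\<close> determines only the
  symmetric part of P: by \<open>\<delta>\<^bsub>[a\<^esub>\<^sup>c\<epsilon>\<^bsub>bd]\<^esub> = 0\<close>, a skew part of P can be absorbed into \<open>\<beta>\<close>. As usual, it is
  normalised by \<open>\<beta>\<^bsub>ab\<^esub> = P\<^bsub>ba\<^esub> - P\<^bsub>ab\<^esub>\<close> (in higher dimensions a consequence of the Bianchi identity).
  This makes P unique, and gives \<open>\<beta> = 0\<close> and symmetric P when there is a parallel volume form,
  since the trace of the curvature over its last two indices is \<open>3\<beta>\<^bsub>ab\<^esub>\<close>.\<close>

definition schouten_on ::
  "(real^2) set \<Rightarrow> (2 \<Rightarrow> 2 \<Rightarrow> 2 \<Rightarrow> scalar) \<Rightarrow> (2 \<Rightarrow> 2 \<Rightarrow> scalar) \<Rightarrow> bool" where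
  "schouten_on S \<Gamma> P \<longleftrightarrow> (\<exists>R \<beta>. curvature_on S \<Gamma> R \<and>
     (\<forall>x\<in>S. \<forall>a b.
        \<beta> a b x = - \<beta> b a x \<and>
        \<beta> a b x = P b a x - P a b x \<and>
        (\<forall>c d. R a b d c x
           = kdelta a c * P b d x - kdelta b c * P a d x + \<beta> a b x * kdelta c d)))"

definition schouten :: "'m chart set \<Rightarrow> 'm connection \<Rightarrow> 'm tensor2 \<Rightarrow> bool" where
  "schouten A \<Gamma> P \<longleftrightarrow> (\<forall>\<kappa>\<in>A. schouten_on (coords \<kappa>) (\<Gamma> \<kappa>) (P \<kappa>))"


section \<open>The obstruction\<close>

definition symm :: "(2 \<Rightarrow> 2 \<Rightarrow> real) \<Rightarrow> 2 \<Rightarrow> 2 \<Rightarrow> real" where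
  "symm t a b = (t a b + t b a) / 2"

context
  fixes \<Gamma> :: "2 \<Rightarrow> 2 \<Rightarrow> 2 \<Rightarrow> scalar"
    and \<epsilon> :: "2 \<Rightarrow> 2 \<Rightarrow> scalar"
    and P :: "2 \<Rightarrow> 2 \<Rightarrow> scalar"
begin

definition Y3 :: "2 \<Rightarrow> 2 \<Rightarrow> 2 \<Rightarrow> scalar" where
  "Y3 a b c x = (1/2) * (cov2 \<Gamma> P a b c x - cov2 \<Gamma> P b a c x)"

definition Y1 :: "2 \<Rightarrow> scalar" where
  "Y1 c x = (\<Sum>a\<in>UNIV. \<Sum>b\<in>UNIV. \<epsilon> a b x * cov2 \<Gamma> P a b c x)"

definition Z2 :: "2 \<Rightarrow> 2 \<Rightarrow> scalar" where
  "Z2 a b x = symm (\<lambda>a b. cov1 \<Gamma> Y1 a b x) a b"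

definition P_ten :: "2 \<Rightarrow> scalar" where
  "P_ten a x = 5 * Y1 a x"

definition Q_ten :: "2 \<Rightarrow> 2 \<Rightarrow> scalar" where
  "Q_ten a b x = 12 * Z2 a b x"

definition R_ten :: "2 \<Rightarrow> scalar" where
  "R_ten c x = 5 * Y1 c x"

definition S_ten :: "2 \<Rightarrow> 2 \<Rightarrow> scalar" where
  "S_ten c a x = 5 * cov1 \<Gamma> Y1 a c x + 2 * Z2 a c x"

definition T_ten :: "2 \<Rightarrow> 2 \<Rightarrow> 2 \<Rightarrow> scalar" where
  "T_ten c a b x =
     5 * symm (\<lambda>a b. cov2 \<Gamma> (cov1 \<Gamma> Y1) a b c x) a b
     + 4 * symm (\<lambda>a b. cov2 \<Gamma> Z2 a b c x) a b
     - 5 * P a b x * Y1 c x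
     - 15 * symm (\<lambda>a b. P c a x * Y1 b x) a b"

definition U_ten :: "2 \<Rightarrow> 2 \<Rightarrow> scalar" where
  "U_ten c d x = Z2 c d x"

definition V_ten :: "2 \<Rightarrow> 2 \<Rightarrow> 2 \<Rightarrow> scalar" where
  "V_ten c d a x = cov2 \<Gamma> Z2 a c d x - 5 * symm (\<lambda>c d. P a c x * Y1 d x) c d"

definition X_ten :: "2 \<Rightarrow> 2 \<Rightarrow> 2 \<Rightarrow> 2 \<Rightarrow> scalar" where
  "X_ten c d a b x =
     symm (\<lambda>a b. cov3 \<Gamma> (cov2 \<Gamma> Z2) a b c d x) a b
     - 5 * symm (\<lambda>a b. symm (\<lambda>c d. cov2 \<Gamma> P a b c x * Y1 d x) c d) a b
     - 5 * symm (\<lambda>a b. P c a x * cov1 \<Gamma> Y1 b d x) a b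
     - 5 * symm (\<lambda>a b. P d a x * cov1 \<Gamma> Y1 b c x) a b
     - symm (\<lambda>a b. P c a x * Z2 b d x) a b
     - symm (\<lambda>a b. P d a x * Z2 b c x) a b
     + 10 * symm (\<lambda>a b. symm (\<lambda>c d. Y1 a x * Y3 b c d x) c d) a b"

text \<open>Inside the following definition, P denotes the one-form \<open>P\<^bsub>a\<^esub>\<close>, not the Schouten tensor.\<close>

definition obstruction :: scalar where
  "obstruction x =
    (let E = (\<lambda>a b. \<epsilon> a b x);
         P = (\<lambda>a. P_ten a x); Q = (\<lambda>a b. Q_ten a b x);
         R = (\<lambda>c. R_ten c x); S = (\<lambda>c a. S_ten c a x);
         T = (\<lambda>c a b. T_ten c a b x); U = (\<lambda>c d. U_ten c d x);
         V = (\<lambda>c d a. V_ten c d a x); X = (\<lambda>c d a b. X_ten c d a b x)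
     in \<Sum>a\<in>UNIV. \<Sum>b\<in>UNIV. \<Sum>c\<in>UNIV. \<Sum>d\<in>UNIV. \<Sum>e\<in>UNIV. \<Sum>f\<in>UNIV. \<Sum>g\<in>UNIV. \<Sum>h\<in>UNIV.
        \<Sum>i\<in>UNIV. \<Sum>j\<in>UNIV. \<Sum>k\<in>UNIV. \<Sum>l\<in>UNIV. \<Sum>m\<in>UNIV. \<Sum>n\<in>UNIV. \<Sum>p\<in>UNIV. \<Sum>q\<in>UNIV.
          E a b * E c d * E e f * E g h * E i j * E k l * E m n * E p q *
          (Q g i * S m p * T n j k * U a c * V d e q * X b f h l
           - (1/6) * P p * R m * S n q * X a c g i * X b e h k * X d f j l
           - (1/2) * P p * S m q * T n j l * U c e * X a d g k * X b f h i
           - (1/2) * P p * T m g i * T n j k * U a c * V d e q * X b f h l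
           + (1/2) * P p * R m * T n g i * V a c q * X d e j k * X b f h l
           - (1/2) * Q g i * R m * S n p * V a c q * X d e j k * X b f h l
           - (1/2) * Q g i * R m * T n j k * V a c p * V d e q * X b f h l
           - (1/4) * Q g i * S m p * S n q * U a c * X d e j k * X b f h l
           - (1/4) * Q g i * T m j k * T n h l * U a c * V d e p * V b f q))"

end

end

theory Submission
  imports Defs
begin

text \<open>
  Let \<open>\<sigma>\<^bsup>bc\<^esup>\<close> be the inverse metric, multiplied by the power of its determinant (measured by \<open>\<epsilon>\<close>) for
  which \<open>\<nabla>\<^sub>a \<sigma>\<^bsup>bc\<^esup> = \<delta>\<^sub>a\<^sup>b \<mu>\<^sup>c + \<delta>\<^sub>a\<^sup>c \<mu>\<^sup>b\<close> for some vector field \<open>\<mu>\<close>. Commuting derivatives closes this equation up: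
  \<open>\<nabla>\<^sub>a \<mu>\<^sup>b = \<delta>\<^sub>a\<^sup>b \<rho> - P\<^bsub>ac\<^esub> \<sigma>\<^bsup>bc\<^esup>\<close> and \<open>\<nabla>\<^sub>a \<rho> = - 2 P\<^bsub>ab\<^esub> \<mu>\<^sup>b + 2 Y\<^bsub>abc\<^esub> \<sigma>\<^bsup>bc\<^esup>\<close> for a scalar \<open>\<rho>\<close>. Commuting derivatives of \<open>\<rho>\<close>
  gives the linear constraint \<open>Z\<^bsub>cd\<^esub> \<sigma>\<^bsup>cd\<^esup> + 5 Y\<^sub>c \<mu>\<^sup>c = 0\<close>; together with its first and its symmetrised second
  derivatives this makes six homogeneous linear equations for the six components of \<open>(\<sigma>, \<mu>, \<rho>)\<close>,
  with coefficients U, R; V, S, P; X, T, Q. As \<open>\<sigma> \<noteq> 0\<close>, the determinant of the system vanishes, and the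
  obstruction is \<open>- (\<epsilon>\<^bsup>12\<^esup>)\<^sup>8\<close> times this determinant when \<open>2 \<sigma>\<^bsup>12\<^esup>\<close> is taken as unknown.
\<close>


section \<open>Calculus on open subsets of the plane\<close>

lemma partial_eqI: "(f has_derivative F) (at x) \<Longrightarrow> partial a f x = F (axis a 1)"
  by (metis frechet_derivative_at partial_def)

text \<open>The identities to be differentiated later hold only on the coordinate domain; as it is
  open, the derivative sees only values there.\<close>

lemma partial_cong:
  assumes "open S" "x \<in> S" "\<And>y. y \<in> S \<Longrightarrow> f y = g y"
  shows "partial a f x = partial a g x"
proof -
  have "(f has_derivative F) (at x) \<longleftrightarrow> (g has_derivative F) (at x)" for F
    using has_derivative_transform_within_open[OF _ assms(1,2)] assms(3) by metis
  thus ?thesis by (simp add: partial_def frechet_derivative_def)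
qed

lemma partial_const [simp]: "partial a (\<lambda>x. c) x = 0"
  by (rule partial_eqI[of _ "\<lambda>_. 0", simplified]) auto

lemma
  assumes "f differentiable at x" "g differentiable at x"
  shows partial_add: "partial a (\<lambda>x. f x + g x) x = partial a f x + partial a g x"
    and partial_diff: "partial a (\<lambda>x. f x - g x) x = partial a f x - partial a g x"
    and partial_mult: "partial a (\<lambda>x. f x * g x) x = partial a f x * g x + f x * partial a g x"
proof -
  note d = assms[unfolded frechet_derivative_works]
  show "partial a (\<lambda>x. f x + g x) x = partial a f x + partial a g x"
    using partial_eqI[OF has_derivative_add[OF d]] by (simp add: partial_def)
  show "partial a (\<lambda>x. f x - g x) x = partial a f x - partial a g x"
    using partial_eqI[OF has_derivative_diff[OF d]] by (simp add: partial_def)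
  show "partial a (\<lambda>x. f x * g x) x = partial a f x * g x + f x * partial a g x"
    using partial_eqI[OF has_derivative_mult[OF d]] by (simp add: partial_def)
qed

lemma partial_minus:
  assumes "f differentiable at x"
  shows "partial a (\<lambda>x. - f x) x = - partial a f x"
  using partial_eqI[OF has_derivative_minus[OF assms[unfolded frechet_derivative_works]]]
  by (simp add: partial_def)

lemma partial_divide_const:
  "f differentiable at x \<Longrightarrow> partial a (\<lambda>x. f x / c) x = partial a f x / c"
  using partial_mult[of f x "\<lambda>_. inverse c" a] by (simp add: divide_inverse)

lemma
  assumes "(F has_real_derivative F') (at (f x))" "f differentiable at x"
  shows partial_compose: "partial a (\<lambda>x. F (f x)) x = F' * partial a f x"
    and differentiable_compose: "(\<lambda>x. F (f x)) differentiable at x"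
proof -
  have "((\<lambda>x. F (f x)) has_derivative (\<lambda>t. F' * frechet_derivative f (at x) t)) (at x)"
    using has_derivative_compose[OF assms(2)[unfolded frechet_derivative_works]
      assms(1)[unfolded has_field_derivative_def]] .
  thus "partial a (\<lambda>x. F (f x)) x = F' * partial a f x" "(\<lambda>x. F (f x)) differentiable at x"
    by (auto simp: partial_def differentiable_def dest: partial_eqI)
qed

section \<open>Smooth functions: locality and closure properties\<close>

lemma Ck_on_cong:
  assumes "open S" "\<And>x. x \<in> S \<Longrightarrow> f x = g x" "Ck_on k S f"
  shows "Ck_on k S g"
  using assms
proof (induction k arbitrary: f g)
  case 0
  then show ?case using continuous_on_cong by (metis Ck_on.simps(1))
next
  case (Suc k)
  show ?case unfolding Ck_on.simps
  proof safe
    fix x assume "x \<in> S"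
    with Suc.prems show "g differentiable at x"
      unfolding differentiable_def
      using has_derivative_transform_within_open by (metis Ck_on.simps(2) differentiable_def)
  next
    fix a show "Ck_on k S (partial a g)"
    proof (rule Suc.IH)
      show "partial a f x = partial a g x" if "x \<in> S" for x
        using partial_cong Suc.prems that by blast
    qed (use Suc.prems in auto)
  qed
qed

lemma Ck_on_SucD: "Ck_on (Suc k) S f \<Longrightarrow> Ck_on k S f"
proof (induction k arbitrary: f)
  case 0
  then show ?case
    by (simp add: continuous_on_eq_continuous_within differentiable_imp_continuous_within
        differentiable_at_withinI)
qed simp

lemma Ck_on_const: "Ck_on k S (\<lambda>x. c)"
proof (induction k arbitrary: c)
  case (Suc k)
  have "partial a (\<lambda>x. c) = (\<lambda>x. 0)" for a by (rule ext) simp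
  with Suc show ?case by simp
qed simp

lemma Ck_on_add:
  "open S \<Longrightarrow> Ck_on k S f \<Longrightarrow> Ck_on k S g \<Longrightarrow> Ck_on k S (\<lambda>x. f x + g x)"
proof (induction k arbitrary: f g)
  case (Suc k)
  have "Ck_on k S (partial a (\<lambda>x. f x + g x))" for a
    by (rule Ck_on_cong[OF Suc.prems(1), of "\<lambda>x. partial a f x + partial a g x"])
      (use Suc in \<open>auto simp: partial_add\<close>)
  with Suc.prems show ?case by simp
qed (simp add: continuous_on_add)

lemma Ck_on_mult:
  "open S \<Longrightarrow> Ck_on k S f \<Longrightarrow> Ck_on k S g \<Longrightarrow> Ck_on k S (\<lambda>x. f x * g x)"
proof (induction k arbitrary: f g)
  case (Suc k)
  have "Ck_on k S (partial a (\<lambda>x. f x * g x))" for a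
    by (rule Ck_on_cong[OF Suc.prems(1), of "\<lambda>x. partial a f x * g x + f x * partial a g x"])
      (use Suc Ck_on_SucD in \<open>auto simp: partial_mult intro!: Ck_on_add\<close>)
  with Suc.prems show ?case by simp
qed (simp add: continuous_on_mult)

lemma smooth_on_const [simp]: "smooth_on S (\<lambda>x. c)"
  by (simp add: smooth_on_def Ck_on_const)

lemma
  assumes "open S" "smooth_on S f" "smooth_on S g"
  shows smooth_on_add: "smooth_on S (\<lambda>x. f x + g x)"
    and smooth_on_mult: "smooth_on S (\<lambda>x. f x * g x)"
  using assms by (auto simp: smooth_on_def Ck_on_add Ck_on_mult)

lemma smooth_on_minus:
  assumes "open S" "smooth_on S f"
  shows "smooth_on S (\<lambda>x. - f x)"
  using smooth_on_mult[OF assms(1) smooth_on_const assms(2), of "- 1"] by simp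

lemma smooth_on_diff:
  assumes "open S" "smooth_on S f" "smooth_on S g"
  shows "smooth_on S (\<lambda>x. f x - g x)"
  using smooth_on_add[OF assms(1,2) smooth_on_minus[OF assms(1,3)]] by simp

lemma smooth_on_sum:
  assumes "open S" "\<And>i. smooth_on S (f i)"
  shows "smooth_on S (\<lambda>x. \<Sum>i\<in>I. f i x)"
  by (induction I rule: infinite_finite_induct) (auto intro: smooth_on_add assms)

lemma smooth_on_partial: "smooth_on S f \<Longrightarrow> smooth_on S (partial a f)"
  unfolding smooth_on_def by (metis Ck_on.simps(2))

lemma smooth_on_differentiable: "smooth_on S f \<Longrightarrow> x \<in> S \<Longrightarrow> f differentiable at x"
  by (auto simp: smooth_on_def dest: spec[of _ "Suc 0"])

lemma smooth_on_cong:
  "open S \<Longrightarrow> (\<And>x. x \<in> S \<Longrightarrow> f x = g x) \<Longrightarrow> smooth_on S f \<Longrightarrow> smooth_on S g"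
  using Ck_on_cong unfolding smooth_on_def by blast

lemmas smooth_intros = smooth_on_add smooth_on_mult smooth_on_minus smooth_on_diff smooth_on_sum
  smooth_on_partial smooth_on_const

text \<open>Bootstrapping: if h is C^n, then so is each product of h with \<open>k a\<close>, hence
  h is C^(n+1). This yields smoothness of \<open>weight\<close> from its first derivative
  alone.\<close>

lemma smooth_on_log_derivative:
  assumes "open S" "\<And>x. x \<in> S \<Longrightarrow> h differentiable at x"
    and "\<And>a x. x \<in> S \<Longrightarrow> partial a h x = h x * k a x" "\<And>a. smooth_on S (k a)"
  shows "smooth_on S h"
proof -
  have "Ck_on n S h" for n
  proof (induction n)
    case 0
    then show ?case using assms(2)
      by (simp add: continuous_on_eq_continuous_within differentiable_imp_continuous_within
          differentiable_at_withinI)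
  next
    case (Suc n)
    have "Ck_on n S (partial a h)" for a
      by (rule Ck_on_cong[OF assms(1), of "\<lambda>x. h x * k a x"])
        (use assms Suc in \<open>auto simp: smooth_on_def intro!: Ck_on_mult\<close>)
    with assms(2) show ?case by simp
  qed
  thus ?thesis by (simp add: smooth_on_def)
qed

section \<open>Symmetry of second partial derivatives\<close>

text \<open>The expression for the second difference is symmetric in a and b, which yields the equality
  of mixed partial derivatives below.\<close>

lemma second_difference_mvt:
  fixes f :: scalar
  assumes S: "open S" "smooth_on S f" and h: "0 < h" "cball x (2 * h) \<subseteq> S"
  obtains \<xi> where "\<xi> \<in> cball x (2 * h)"
    "f (x + h *\<^sub>R axis a 1 + h *\<^sub>R axis b 1) - f (x + h *\<^sub>R axis a 1) - f (x + h *\<^sub>R axis b 1) + f x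
       = h\<^sup>2 * partial b (partial a f) \<xi>"
proof -
  let ?A = "axis a 1 :: real^2" and ?B = "axis b 1 :: real^2"
  have cb: "x + s *\<^sub>R ?A + t *\<^sub>R ?B \<in> cball x (2 * h)" if "\<bar>s\<bar> \<le> h" "\<bar>t\<bar> \<le> h" for s t
  proof -
    have "norm (s *\<^sub>R ?A + t *\<^sub>R ?B) \<le> norm (s *\<^sub>R ?A) + norm (t *\<^sub>R ?B)" by (rule norm_triangle_ineq)
    also have "\<dots> \<le> 2 * h" using that by (simp add: norm_axis_1)
    finally have "dist x (x + (s *\<^sub>R ?A + t *\<^sub>R ?B)) \<le> 2 * h"
      by (metis add_diff_cancel_left' dist_commute dist_norm)
    thus ?thesis by (simp add: add.assoc)
  qed
  have line: "((\<lambda>s. g (p + s *\<^sub>R axis c 1)) has_real_derivative partial c g (p + s *\<^sub>R axis c 1)) (at s)"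
    if "smooth_on S g" "p + s *\<^sub>R axis c 1 \<in> S" for g :: scalar and p s c
  proof -
    have "(g has_derivative frechet_derivative g (at (p + s *\<^sub>R axis c 1))) (at (p + s *\<^sub>R axis c 1))"
      using smooth_on_differentiable[OF that] by (simp add: frechet_derivative_works)
    hence "((\<lambda>s. g (p + s *\<^sub>R axis c 1)) has_derivative
        (\<lambda>t. frechet_derivative g (at (p + s *\<^sub>R axis c 1)) (t *\<^sub>R axis c 1))) (at s)"
      by (rule has_derivative_compose[rotated]) (auto intro!: derivative_eq_intros)
    moreover have "frechet_derivative g (at (p + s *\<^sub>R axis c 1)) (t *\<^sub>R axis c 1)
        = partial c g (p + s *\<^sub>R axis c 1) * t" for t
      using linear_frechet_derivative[OF smooth_on_differentiable[OF that]]
      by (simp add: partial_def linear_cmul mult.commute)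
    ultimately show ?thesis by (simp add: has_field_derivative_def)
  qed
  \<comment> \<open>The second difference is the increment of \<open>\<phi>\<close> over [0, h]. The
    mean value theorem is applied to \<open>\<phi>\<close> in direction a, then to
    \<open>partial a f\<close> in direction b.\<close>
  define \<phi> where "\<phi> s = f ((x + h *\<^sub>R ?B) + s *\<^sub>R ?A) - f (x + s *\<^sub>R ?A)" for s
  have inS: "x + s *\<^sub>R ?A + t *\<^sub>R ?B \<in> S" if "\<bar>s\<bar> \<le> h" "\<bar>t\<bar> \<le> h" for s t
    using cb[OF that] h by auto
  have "(\<phi> has_real_derivative
      partial a f ((x + h *\<^sub>R ?B) + s *\<^sub>R ?A) - partial a f (x + s *\<^sub>R ?A)) (at s)"
    if "0 \<le> s" "s \<le> h" for s
    unfolding \<phi>_def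
    by (intro DERIV_diff line S) (use inS[of s h] inS[of s 0] that h in \<open>auto simp: add_ac\<close>)
  from MVT2[OF h(1) this] obtain s where s: "0 < s" "s < h"
    "\<phi> h - \<phi> 0 = h * (partial a f ((x + h *\<^sub>R ?B) + s *\<^sub>R ?A) - partial a f (x + s *\<^sub>R ?A))"
    by auto
  have "((\<lambda>t. partial a f ((x + s *\<^sub>R ?A) + t *\<^sub>R ?B)) has_real_derivative
      partial b (partial a f) ((x + s *\<^sub>R ?A) + t *\<^sub>R ?B)) (at t)" if "0 \<le> t" "t \<le> h" for t
    by (intro line smooth_on_partial S) (use inS[of s t] s that in auto)
  from MVT2[OF h(1) this] obtain t where t: "0 < t" "t < h"
    "partial a f ((x + s *\<^sub>R ?A) + h *\<^sub>R ?B) - partial a f ((x + s *\<^sub>R ?A) + 0 *\<^sub>R ?B)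
      = h * partial b (partial a f) ((x + s *\<^sub>R ?A) + t *\<^sub>R ?B)"
    by auto
  show ?thesis
  proof
    show "x + s *\<^sub>R ?A + t *\<^sub>R ?B \<in> cball x (2 * h)" using s t by (intro cb) auto
    show "f (x + h *\<^sub>R ?A + h *\<^sub>R ?B) - f (x + h *\<^sub>R ?A) - f (x + h *\<^sub>R ?B) + f x
       = h\<^sup>2 * partial b (partial a f) (x + s *\<^sub>R ?A + t *\<^sub>R ?B)"
      using s(3) t(3) by (simp add: \<phi>_def add_ac power2_eq_square)
  qed
qed

lemma partial_commute:
  assumes S: "open S" "smooth_on S f" and x: "x \<in> S"
  shows "partial a (partial b f) x = partial b (partial a f) x"
proof (rule ccontr)
  assume ne: "partial a (partial b f) x \<noteq> partial b (partial a f) x"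
  \<comment> \<open>Half the gap: near x each mixed derivative stays within e of its value at x, and
    both attain one common value there, possibly at different points.\<close>
  define e where "e = dist (partial a (partial b f) x) (partial b (partial a f) x) / 2"
  have e: "e > 0" using ne by (simp add: e_def)
  have "\<exists>d>0. \<forall>y. dist y x \<le> d \<longrightarrow> dist (partial c (partial d' f) y) (partial c (partial d' f) x) < e" for c d'
  proof -
    have "isCont (partial c (partial d' f)) x"
      using smooth_on_differentiable[OF smooth_on_partial[OF smooth_on_partial[OF S(2)]] x]
      by (rule differentiable_imp_continuous_within)
    then obtain d where "d > 0" "\<forall>y. dist y x < d \<longrightarrow> dist (partial c (partial d' f) y) (partial c (partial d' f) x) < e"
      using e unfolding continuous_at_eps_delta by blast
    thus ?thesis by (intro exI[of _ "d / 2"]) auto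
  qed
  note cont = this
  obtain d1 where d1: "d1 > 0" "\<And>y. dist y x \<le> d1 \<Longrightarrow> dist (partial a (partial b f) y) (partial a (partial b f) x) < e"
    using cont by metis
  obtain d2 where d2: "d2 > 0" "\<And>y. dist y x \<le> d2 \<Longrightarrow> dist (partial b (partial a f) y) (partial b (partial a f) x) < e"
    using cont by metis
  obtain r where r: "r > 0" "cball x r \<subseteq> S" using S(1) x open_contains_cball by blast
  \<comment> \<open>Halved because the intermediate points range over a ball of radius 2h.\<close>
  define h where "h = min r (min d1 d2) / 2"
  have h: "h > 0" "2 * h \<le> r" "2 * h \<le> d1" "2 * h \<le> d2" using r d1 d2 by (auto simp: h_def)
  have sub: "cball x (2 * h) \<subseteq> S" using r h by auto
  obtain \<xi> where \<xi>: "\<xi> \<in> cball x (2 * h)"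
    "f (x + h *\<^sub>R axis a 1 + h *\<^sub>R axis b 1) - f (x + h *\<^sub>R axis a 1) - f (x + h *\<^sub>R axis b 1) + f x
       = h\<^sup>2 * partial b (partial a f) \<xi>"
    by (rule second_difference_mvt[OF S h(1) sub])
  obtain \<eta> where \<eta>: "\<eta> \<in> cball x (2 * h)"
    "f (x + h *\<^sub>R axis b 1 + h *\<^sub>R axis a 1) - f (x + h *\<^sub>R axis b 1) - f (x + h *\<^sub>R axis a 1) + f x
       = h\<^sup>2 * partial a (partial b f) \<eta>"
    by (rule second_difference_mvt[OF S h(1) sub])
  have swap: "x + h *\<^sub>R axis b 1 + h *\<^sub>R axis a 1 = x + h *\<^sub>R axis a 1 + h *\<^sub>R axis b 1"
    by (simp add: add_ac)
  have "h\<^sup>2 * partial b (partial a f) \<xi> = h\<^sup>2 * partial a (partial b f) \<eta>"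
    using \<xi>(2) \<eta>(2)[unfolded swap] by linarith
  hence eq: "partial b (partial a f) \<xi> = partial a (partial b f) \<eta>"
    using h(1) by (simp only: mult_cancel_left power_eq_0_iff) simp
  have "dist (partial b (partial a f) \<xi>) (partial b (partial a f) x) < e"
    by (rule d2(2)) (use \<xi>(1) h in \<open>auto simp: dist_commute\<close>)
  moreover have "dist (partial a (partial b f) \<eta>) (partial a (partial b f) x) < e"
    by (rule d1(2)) (use \<eta>(1) h in \<open>auto simp: dist_commute\<close>)
  ultimately have "dist (partial a (partial b f) x) (partial b (partial a f) x) < e + e"
    unfolding eq by (metis add_strict_mono dist_commute dist_triangle3 le_less_trans)
  thus False by (simp add: e_def)
qed


section \<open>Prolongation of the metrisability equation\<close>

text \<open>One chart suffices, since the conclusion concerns components at each point of each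
  chart. By skewness \<open>\<epsilon> 1 2\<close> carries all of the bivector.\<close>

locale special_connection =
  fixes S :: "(real^2) set" and \<Gamma> :: "2 \<Rightarrow> 2 \<Rightarrow> 2 \<Rightarrow> scalar" and \<epsilon> :: "2 \<Rightarrow> 2 \<Rightarrow> scalar"
  assumes open_S: "open S"
    and smooth_\<Gamma>: "smooth_on S (\<Gamma> c a b)"
    and smooth_\<epsilon>: "smooth_on S (\<epsilon> a b)"
    and \<Gamma>_sym: "x \<in> S \<Longrightarrow> \<Gamma> c a b x = \<Gamma> c b a x"
    and \<epsilon>_skew: "x \<in> S \<Longrightarrow> \<epsilon> a b x = - \<epsilon> b a x"
    and \<epsilon>_nonzero: "x \<in> S \<Longrightarrow> \<epsilon> 1 2 x \<noteq> 0"
    and \<epsilon>_parallel: "x \<in> S \<Longrightarrow> cov_bivector \<Gamma> \<epsilon> a b c x = 0"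
begin

lemmas smooth_S = smooth_intros(1-5)[OF open_S] smooth_intros(6,7)

lemma diff_S: "smooth_on S f \<Longrightarrow> x \<in> S \<Longrightarrow> f differentiable at x"
  by (rule smooth_on_differentiable)

lemmas partial_S = partial_add partial_diff partial_mult partial_minus

lemma
  assumes "\<And>a. smooth_on S (w a)"
  shows smooth_cov1: "smooth_on S (cov1 \<Gamma> w a b)"
    and smooth_cov_vector: "smooth_on S (cov_vector \<Gamma> w a b)"
  unfolding cov1_def cov_vector_def by (intro smooth_S smooth_\<Gamma> assms)+

lemma smooth_cov2:
  assumes "\<And>a b. smooth_on S (w a b)"
  shows "smooth_on S (cov2 \<Gamma> w a b c)"
  unfolding cov2_def by (intro smooth_S smooth_\<Gamma> assms)+

lemma \<epsilon>_diag: "x \<in> S \<Longrightarrow> \<epsilon> a a x = 0"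
  using \<epsilon>_skew[of x a a] by simp

lemma partial_\<epsilon>:
  assumes x: "x \<in> S"
  shows "partial a (\<epsilon> 1 2) x = - (\<Sum>d\<in>UNIV. \<Gamma> d a d x) * \<epsilon> 1 2 x"
  using \<epsilon>_parallel[OF x, of a 1 2] 
  by (simp add: cov_bivector_def sum_2 \<epsilon>_diag[OF x] algebra_simps)

text \<open>By \<open>partial_\<epsilon>\<close> the trace of the symbols is minus the gradient of
  log |\<epsilon>^12|, hence a closed form.\<close>

lemma trace_closed:
  assumes x: "x \<in> S"
  shows "(\<Sum>d\<in>UNIV. partial a (\<Gamma> d b d) x) = (\<Sum>d\<in>UNIV. partial b (\<Gamma> d a d) x)"
proof -
  have *: "partial c (partial a (\<epsilon> 1 2)) x
      = - (\<Sum>d\<in>UNIV. partial c (\<Gamma> d a d) x) * \<epsilon> 1 2 x + (\<Sum>d\<in>UNIV. \<Gamma> d a d x) * (\<Sum>d\<in>UNIV. \<Gamma> d c d x) * \<epsilon> 1 2 x"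
    for a c
  proof -
    have "partial c (partial a (\<epsilon> 1 2)) x = partial c (\<lambda>x. - (\<Sum>d\<in>UNIV. \<Gamma> d a d x) * \<epsilon> 1 2 x) x"
      by (rule partial_cong[OF open_S x partial_\<epsilon>])
    thus ?thesis using x
      by (simp add: sum_2 partial_S diff_S smooth_S smooth_\<Gamma> smooth_\<epsilon> partial_\<epsilon> algebra_simps)
  qed
  have "partial a (partial b (\<epsilon> 1 2)) x = partial b (partial a (\<epsilon> 1 2)) x"
    by (rule partial_commute[OF open_S smooth_\<epsilon> x])
  thus ?thesis unfolding * using \<epsilon>_nonzero[OF x] by (simp add: algebra_simps)
qed

text \<open>The Ricci identity is tested on the d-th coordinate vector field, whose covariant
  derivative is given by the symbols themselves.\<close>

lemma curvature_on_components:
  assumes R: "curvature_on S \<Gamma> R" and x: "x \<in> S"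
  shows "R a b d c x = partial a (\<Gamma> c b d) x - partial b (\<Gamma> c a d) x
        + (\<Sum>e\<in>UNIV. \<Gamma> c a e x * \<Gamma> e b d x) - (\<Sum>e\<in>UNIV. \<Gamma> c b e x * \<Gamma> e a d x)"
proof -
  let ?X = "\<lambda>c (x :: real^2). kdelta c d"
  have X: "cov_vector \<Gamma> ?X b c = \<Gamma> c b d" for b c
    using exhaust_2[of d] by (intro ext) (auto simp: cov_vector_def sum_2 kdelta_def)
  have "cov_mixed \<Gamma> (cov_vector \<Gamma> ?X) a b c x - cov_mixed \<Gamma> (cov_vector \<Gamma> ?X) b a c x
      = (\<Sum>e\<in>UNIV. R a b e c x * kdelta e d)"
    using R x unfolding curvature_on_def by (auto simp: smooth_on_const)
  also have "\<dots> = R a b d c x"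
    using exhaust_2[of d] by (auto simp: sum_2 kdelta_def)
  finally show ?thesis
    by (simp add: cov_mixed_def X \<Gamma>_sym[OF x, of _ b a] algebra_simps)
qed

end

section \<open>Curvature, the Schouten tensor and tensors derived from it\<close>

locale schouten_connection = special_connection +
  fixes P :: "2 \<Rightarrow> 2 \<Rightarrow> scalar"
  assumes schouten: "schouten_on S \<Gamma> P"
begin

text \<open>The trace of the curvature over its last two indices is P_ba - P_ab + 2 \<beta>_ab = 3
  \<beta>_ab, and it vanishes by \<open>trace_closed\<close>. So \<beta> = 0 and P is
  symmetric.\<close>

lemma
  assumes x: "x \<in> S"
  shows P_sym: "P a b x = P b a x"
    and curvature: "partial a (\<Gamma> c b d) x - partial b (\<Gamma> c a d) x
        + (\<Sum>e\<in>UNIV. \<Gamma> c a e x * \<Gamma> e b d x) - (\<Sum>e\<in>UNIV. \<Gamma> c b e x * \<Gamma> e a d x)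
      = kdelta a c * P b d x - kdelta b c * P a d x"
proof -
  obtain R \<beta> where R: "curvature_on S \<Gamma> R"
    and \<beta>: "\<beta> a b x = P b a x - P a b x"
    and R\<beta>: "R a b d c x = kdelta a c * P b d x - kdelta b c * P a d x + \<beta> a b x * kdelta c d" for a b c d
    using schouten x unfolding schouten_on_def by metis
  have "(\<Sum>d\<in>UNIV. R a b d d x) = 0"
    using trace_closed[OF x, of a b] by (simp add: curvature_on_components[OF R x] sum_2 algebra_simps)
  moreover have "(\<Sum>d\<in>UNIV. R a b d d x) = 3 * \<beta> a b x"
    using exhaust_2[of a] exhaust_2[of b]
    by (elim disjE; simp add: R\<beta> \<beta> sum_2 kdelta_def)
  ultimately have 0: "\<beta> a b x = 0" by simp
  with \<beta> show "P a b x = P b a x" by simp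
  show "partial a (\<Gamma> c b d) x - partial b (\<Gamma> c a d) x
        + (\<Sum>e\<in>UNIV. \<Gamma> c a e x * \<Gamma> e b d x) - (\<Sum>e\<in>UNIV. \<Gamma> c b e x * \<Gamma> e a d x)
      = kdelta a c * P b d x - kdelta b c * P a d x"
    using R\<beta>[of a b d c] by (simp add: curvature_on_components[OF R x] 0)
qed

text \<open>\<open>schouten_on\<close> speaks of values only. Smoothness comes from the curvature
  components with first indices 1, 2: those with upper index 1 and 2 are P_2b and -P_1b.\<close>

lemma smooth_P: "smooth_on S (P a b)"
proof -
  define r where "r c x = partial 1 (\<Gamma> c 2 b) x - partial 2 (\<Gamma> c 1 b) x
      + (\<Sum>e\<in>UNIV. \<Gamma> c 1 e x * \<Gamma> e 2 b x) - (\<Sum>e\<in>UNIV. \<Gamma> c 2 e x * \<Gamma> e 1 b x)" for c x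
  have r: "smooth_on S (r c)" for c
    unfolding r_def[abs_def] by (intro smooth_S smooth_\<Gamma>)
  have "smooth_on S (P 2 b)"
    by (rule smooth_on_cong[OF open_S _ r[of 1]]) (use curvature[of _ 1 1 2 b] in \<open>simp add: r_def kdelta_def\<close>)
  moreover have "smooth_on S (P 1 b)"
    by (rule smooth_on_cong[OF open_S _ smooth_on_minus[OF open_S r[of 2]]])
      (use curvature[of _ 1 2 2 b] in \<open>simp add: r_def kdelta_def\<close>)
  ultimately show ?thesis using exhaust_2[of a] by auto
qed

abbreviation "Y \<equiv> Y1 \<Gamma> \<epsilon> P"
abbreviation "Z \<equiv> Z2 \<Gamma> \<epsilon> P"

lemma smooth_Y: "smooth_on S (Y c)"
  unfolding Y1_def by (intro smooth_S smooth_\<epsilon> smooth_cov2 smooth_P)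

lemma smooth_Z: "smooth_on S (Z a b)"
  unfolding Z2_def symm_def
  by (subst divide_inverse) (intro smooth_S smooth_cov1 smooth_Y)

lemma Z_sym: "Z a b x = Z b a x"
  by (simp add: Z2_def symm_def)

lemmas smooth_all = smooth_S smooth_\<Gamma> smooth_\<epsilon> smooth_P smooth_Y smooth_Z
  smooth_cov1 smooth_cov_vector smooth_cov2

text \<open>Leibniz rule for a full contraction: being a scalar, it may be differentiated
  covariantly factor by factor, as the connection terms cancel.\<close>

lemma partial_contract:
  assumes "\<And>c d. smooth_on S (w c d)" "\<And>c d. smooth_on S (s c d)" "x \<in> S"
  shows "partial a (\<lambda>x. \<Sum>c\<in>UNIV. \<Sum>d\<in>UNIV. w c d x * s c d x) x
    = (\<Sum>c\<in>UNIV. \<Sum>d\<in>UNIV. cov2 \<Gamma> w a c d x * s c d x + w c d x * cov_bivector \<Gamma> s a c d x)"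
  using assms
  by (simp add: sum_2 partial_S diff_S smooth_all cov2_def cov_bivector_def algebra_simps)

lemma partial_contract1:
  assumes "\<And>c. smooth_on S (w c)" "\<And>c. smooth_on S (X c)" "x \<in> S"
  shows "partial a (\<lambda>x. \<Sum>c\<in>UNIV. w c x * X c x) x
    = (\<Sum>c\<in>UNIV. cov1 \<Gamma> w a c x * X c x + w c x * cov_vector \<Gamma> X a c x)"
  using assms
  by (simp add: sum_2 partial_S diff_S smooth_all cov1_def cov_vector_def algebra_simps)

lemma cov2_slice: "cov1 \<Gamma> (w b) a c x = cov2 \<Gamma> w a b c x + (\<Sum>e\<in>UNIV. \<Gamma> e a b x * w e c x)"
  by (simp add: cov1_def cov2_def)

lemma cov3_slice: "cov2 \<Gamma> (w b) a c d x = cov3 \<Gamma> w a b c d x + (\<Sum>e\<in>UNIV. \<Gamma> e a b x * w e c d x)"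
  by (simp add: cov2_def cov3_def)

lemma Z_eq: "Z a b x = cov1 \<Gamma> Y a b x / 2 + cov1 \<Gamma> Y b a x / 2"
  by (simp add: Z2_def symm_def add_divide_distrib)

lemma cov2_Z_sym: "cov2 \<Gamma> Z a b c x = cov2 \<Gamma> Z a c b x"
proof -
  have "Z b c = Z c b" by (rule ext) (rule Z_sym)
  thus ?thesis by (simp add: cov2_def Z_sym)
qed

text \<open>V and S with the differentiation index first, so that \<open>cov3\<close> and \<open>cov2\<close> apply to them.\<close>

abbreviation "N \<equiv> \<lambda>a c d. V_ten \<Gamma> \<epsilon> P c d a"
abbreviation "M \<equiv> \<lambda>a c. S_ten \<Gamma> \<epsilon> P c a"

lemma N_eq: "N a c d = (\<lambda>x. cov2 \<Gamma> Z a c d x - 5/2 * (P a c x * Y d x) - 5/2 * (P a d x * Y c x))"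
  by (rule ext) (simp add: V_ten_def symm_def field_simps)

lemma M_eq: "M a c = (\<lambda>x. 5 * cov1 \<Gamma> Y a c x + 2 * Z a c x)"
  by (rule ext) (simp add: S_ten_def)

lemma smooth_N: "smooth_on S (N a c d)"
  unfolding N_eq by (intro smooth_all)

lemma smooth_M: "smooth_on S (M a c)"
  unfolding M_eq by (intro smooth_all)

lemma cov_N:
  assumes x: "x \<in> S"
  shows "cov3 \<Gamma> N b a c d x = cov3 \<Gamma> (cov2 \<Gamma> Z) b a c d x
    - 5/2 * (cov2 \<Gamma> P b a c x * Y d x + P a c x * cov1 \<Gamma> Y b d x
           + cov2 \<Gamma> P b a d x * Y c x + P a d x * cov1 \<Gamma> Y b c x)"
  using x unfolding N_eq
  by (simp add: cov3_def[abs_def] cov2_def[of _ P] cov1_def[of _ Y]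
      partial_S partial_divide_const add_divide_distrib diff_S smooth_all sum_2 algebra_simps)

lemma cov_M:
  assumes x: "x \<in> S"
  shows "cov2 \<Gamma> M b a c x = 5 * cov2 \<Gamma> (cov1 \<Gamma> Y) b a c x + 2 * cov2 \<Gamma> Z b a c x"
  using x unfolding M_eq
  by (simp add: cov2_def
      partial_S partial_divide_const add_divide_distrib diff_S smooth_all sum_2 algebra_simps)

end

section \<open>Closing up the equations for \<sigma>, \<mu> and \<rho>\<close>

locale metrisability_solution = schouten_connection +
  fixes \<sigma> :: "2 \<Rightarrow> 2 \<Rightarrow> scalar" and \<mu> :: "2 \<Rightarrow> scalar"
  assumes smooth_\<sigma>: "smooth_on S (\<sigma> a b)" and smooth_\<mu>: "smooth_on S (\<mu> a)"
    and \<sigma>_sym: "x \<in> S \<Longrightarrow> \<sigma> a b x = \<sigma> b a x"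
    and cov_\<sigma>: "x \<in> S \<Longrightarrow> cov_bivector \<Gamma> \<sigma> a b c x = kdelta b a * \<mu> c x + kdelta c a * \<mu> b x"
begin

text \<open>Chosen to make the (1,1) component of \<open>cov_\<mu>\<close> true by definition. That
  lemma shows that the (2,2) component gives the same function, so \<rho> is half the trace of
  \<nabla>_a \<mu>^b + P_ac \<sigma>^bc.\<close>

definition \<rho> :: scalar where
  "\<rho> x = cov_vector \<Gamma> \<mu> 1 1 x + (\<Sum>c\<in>UNIV. P 1 c x * \<sigma> 1 c x)"

lemma partial_\<sigma>: "x \<in> S \<Longrightarrow> partial a (\<sigma> b c) x = kdelta b a * \<mu> c x + kdelta c a * \<mu> b x
    - (\<Sum>d\<in>UNIV. \<Gamma> b a d x * \<sigma> d c x) - (\<Sum>d\<in>UNIV. \<Gamma> c a d x * \<sigma> b d x)"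
  using cov_\<sigma>[of x a b c] by (simp add: cov_bivector_def)

text \<open>The curvature formula oriented as a rewrite rule: it removes
  \<open>partial 1 (\<Gamma> c 2 d)\<close>, so that derivatives of the symbols cancel in every
  commutator.\<close>

lemma curvature_12: "x \<in> S \<Longrightarrow> partial 1 (\<Gamma> c 2 d) x = partial 2 (\<Gamma> c 1 d) x
        - (\<Sum>e\<in>UNIV. \<Gamma> c 1 e x * \<Gamma> e 2 d x) + (\<Sum>e\<in>UNIV. \<Gamma> c 2 e x * \<Gamma> e 1 d x)
        + kdelta 1 c * P 2 d x - kdelta 2 c * P 1 d x"
  using curvature[of x 1 c 2 d] by simp

lemma partial2_\<sigma>:
  assumes "x \<in> S"
  shows "partial e (partial a (\<sigma> b c)) x = partial e (\<lambda>x. kdelta b a * \<mu> c x + kdelta c a * \<mu> b x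
    - (\<Sum>d\<in>UNIV. \<Gamma> b a d x * \<sigma> d c x) - (\<Sum>d\<in>UNIV. \<Gamma> c a d x * \<sigma> b d x)) x"
  by (rule partial_cong[OF open_S assms partial_\<sigma>])

text \<open>The Ricci identity \<open>[\<nabla>\<^sub>1, \<nabla>\<^sub>2] \<sigma>\<^bsup>bc\<^esup>\<close>, with the left-hand side rewritten by means of \<open>cov_\<sigma>\<close>.\<close>

lemma commute_\<sigma>:
  assumes x: "x \<in> S"
  shows "kdelta b 2 * cov_vector \<Gamma> \<mu> 1 c x + kdelta c 2 * cov_vector \<Gamma> \<mu> 1 b x
      - kdelta b 1 * cov_vector \<Gamma> \<mu> 2 c x - kdelta c 1 * cov_vector \<Gamma> \<mu> 2 b x
    = (\<Sum>e\<in>UNIV. (kdelta 1 b * P 2 e x - kdelta 2 b * P 1 e x) * \<sigma> e c x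
         + (kdelta 1 c * P 2 e x - kdelta 2 c * P 1 e x) * \<sigma> b e x)"
proof -
  have "partial 1 (partial 2 (\<sigma> b c)) x = partial 2 (partial 1 (\<sigma> b c)) x"
    by (rule partial_commute[OF open_S smooth_\<sigma> x])
  thus ?thesis unfolding partial2_\<sigma>[OF x]
    using x exhaust_2[of b] exhaust_2[of c]
    by (elim disjE; simp add: sum_2 partial_S diff_S smooth_all smooth_\<sigma> smooth_\<mu>
       partial_\<sigma> curvature_12 cov_vector_def
       kdelta_def \<Gamma>_sym[OF x, of _ 2 1] \<sigma>_sym[OF x, of 2 1] algebra_simps)
qed

text \<open>In \<open>commute_\<sigma>\<close> the components 11 and 22 give the two off-diagonal
  entries, and 12 says that both diagonal entries define the same \<rho>.\<close>

lemma cov_\<mu>: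
  assumes x: "x \<in> S"
  shows "cov_vector \<Gamma> \<mu> a b x = kdelta b a * \<rho> x - (\<Sum>c\<in>UNIV. P a c x * \<sigma> b c x)"
  using commute_\<sigma>[OF x, of 1 1] commute_\<sigma>[OF x, of 1 2] commute_\<sigma>[OF x, of 2 2]
    exhaust_2[of a] exhaust_2[of b]
  by (elim disjE; simp add: \<rho>_def kdelta_def sum_2 \<sigma>_sym[OF x, of 2 1] algebra_simps)

lemma partial_\<mu>: "x \<in> S \<Longrightarrow> partial a (\<mu> b) x = kdelta b a * \<rho> x
    - (\<Sum>c\<in>UNIV. P a c x * \<sigma> b c x) - (\<Sum>d\<in>UNIV. \<Gamma> b a d x * \<mu> d x)"
  using cov_\<mu>[of x a b] by (simp add: cov_vector_def)

lemma smooth_\<rho>: "smooth_on S \<rho>"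
  unfolding \<rho>_def[abs_def] by (intro smooth_all smooth_\<sigma> smooth_\<mu>)

lemma partial2_\<mu>:
  assumes "x \<in> S"
  shows "partial e (partial a (\<mu> b)) x = partial e (\<lambda>x. kdelta b a * \<rho> x
    - (\<Sum>c\<in>UNIV. P a c x * \<sigma> b c x) - (\<Sum>d\<in>UNIV. \<Gamma> b a d x * \<mu> d x)) x"
  by (rule partial_cong[OF open_S assms partial_\<mu>])

text \<open>\<open>curlP c\<close> is twice the component \<open>Y\<^bsub>12c\<^esub>\<close>, that is, \<open>Y\<^sub>c\<close> without the density \<open>\<epsilon>\<^bsup>12\<^esup>\<close>.\<close>

definition curlP :: "2 \<Rightarrow> scalar" where
  "curlP c x = cov2 \<Gamma> P 1 2 c x - cov2 \<Gamma> P 2 1 c x"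

lemma smooth_curlP: "smooth_on S (curlP c)"
  unfolding curlP_def[abs_def] by (intro smooth_all)

lemmas smooth_sol = smooth_all smooth_\<sigma> smooth_\<mu> smooth_\<rho> smooth_curlP

text \<open>The commutator of derivatives of \<mu>^b contains \<rho> through
  \<open>kdelta b 2\<close> times its first derivative minus \<open>kdelta b 1\<close> times its
  second. So b = 2 isolates \<open>partial 1 \<rho>\<close> and b = 1 isolates
  \<open>partial 2 \<rho>\<close>.\<close>

lemma
  assumes x: "x \<in> S"
  shows partial_\<rho>_1: "partial 1 \<rho> x = - 2 * (\<Sum>b\<in>UNIV. P 1 b x * \<mu> b x) + (\<Sum>c\<in>UNIV. curlP c x * \<sigma> 2 c x)"
    and partial_\<rho>_2: "partial 2 \<rho> x = - 2 * (\<Sum>b\<in>UNIV. P 2 b x * \<mu> b x) - (\<Sum>c\<in>UNIV. curlP c x * \<sigma> 1 c x)"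
proof -
  have *: "partial 1 (partial 2 (\<mu> b)) x = partial 2 (partial 1 (\<mu> b)) x" for b
    by (rule partial_commute[OF open_S smooth_\<mu> x])
  show "partial 1 \<rho> x = - 2 * (\<Sum>b\<in>UNIV. P 1 b x * \<mu> b x) + (\<Sum>c\<in>UNIV. curlP c x * \<sigma> 2 c x)"
    using x *[of 2] unfolding partial2_\<mu>[OF x]
    by (simp add: sum_2 partial_S diff_S smooth_sol partial_\<sigma> partial_\<mu> curvature_12 curlP_def cov2_def
       kdelta_def \<Gamma>_sym[OF x, of _ 2 1] \<sigma>_sym[OF x, of 2 1] P_sym[OF x, of 2 1] algebra_simps)
  show "partial 2 \<rho> x = - 2 * (\<Sum>b\<in>UNIV. P 2 b x * \<mu> b x) - (\<Sum>c\<in>UNIV. curlP c x * \<sigma> 1 c x)"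
    using x *[of 1] unfolding partial2_\<mu>[OF x]
    by (simp add: sum_2 partial_S diff_S smooth_sol partial_\<sigma> partial_\<mu> curvature_12 curlP_def cov2_def
       kdelta_def \<Gamma>_sym[OF x, of _ 2 1] \<sigma>_sym[OF x, of 2 1] P_sym[OF x, of 2 1] algebra_simps)
qed

lemma Y_eq_curlP:
  assumes x: "x \<in> S"
  shows "Y c x = \<epsilon> 1 2 x * curlP c x"
  using \<epsilon>_skew[OF x, of 2 1] by (simp add: Y1_def curlP_def sum_2 \<epsilon>_diag[OF x] algebra_simps)

lemma partial_Y:
  assumes x: "x \<in> S"
  shows "partial a (Y c) x = \<epsilon> 1 2 x * (partial a (curlP c) x - (\<Sum>d\<in>UNIV. \<Gamma> d a d x) * curlP c x)"
proof -
  have "partial a (Y c) x = partial a (\<lambda>x. \<epsilon> 1 2 x * curlP c x) x"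
    by (rule partial_cong[OF open_S x Y_eq_curlP])
  thus ?thesis using x by (simp add: partial_S diff_S smooth_sol partial_\<epsilon> algebra_simps)
qed

section \<open>The linear constraint and its first two derivatives\<close>

text \<open>This is the integrability condition \<open>\<partial>\<^sub>1 \<partial>\<^sub>2 \<rho> = \<partial>\<^sub>2 \<partial>\<^sub>1 \<rho>\<close>.\<close>

lemma constraint:
  assumes x: "x \<in> S"
  shows "(\<Sum>c\<in>UNIV. \<Sum>d\<in>UNIV. Z c d x * \<sigma> c d x) + 5 * (\<Sum>c\<in>UNIV. Y c x * \<mu> c x) = 0"
proof -
  have "partial 1 (partial 2 \<rho>) x - partial 2 (partial 1 \<rho>) x = 0"
    using partial_commute[OF open_S smooth_\<rho> x, of 1 2] by simp
  also have "partial 1 (partial 2 \<rho>) x =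
      partial 1 (\<lambda>x. - 2 * (\<Sum>b\<in>UNIV. P 2 b x * \<mu> b x) - (\<Sum>c\<in>UNIV. curlP c x * \<sigma> 1 c x)) x"
    by (rule partial_cong[OF open_S x partial_\<rho>_2])
  also have "partial 2 (partial 1 \<rho>) x =
      partial 2 (\<lambda>x. - 2 * (\<Sum>b\<in>UNIV. P 1 b x * \<mu> b x) + (\<Sum>c\<in>UNIV. curlP c x * \<sigma> 2 c x)) x"
    by (rule partial_cong[OF open_S x partial_\<rho>_1])
  finally have "- (\<Sum>c\<in>UNIV. \<Sum>d\<in>UNIV. (partial d (curlP c) x - (\<Sum>e\<in>UNIV. \<Gamma> e d e x) * curlP c x
      - (\<Sum>e\<in>UNIV. \<Gamma> e d c x * curlP e x)) * \<sigma> c d x) - 5 * (\<Sum>c\<in>UNIV. curlP c x * \<mu> c x) = 0"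
    using x
    by (simp add: sum_2 partial_S diff_S smooth_sol partial_\<sigma> partial_\<mu> partial_\<rho>_1 partial_\<rho>_2
       kdelta_def \<Gamma>_sym[OF x, of _ 2 1] \<sigma>_sym[OF x, of 2 1] P_sym[OF x, of 2 1])
       (simp add: curlP_def cov2_def sum_2 \<Gamma>_sym[OF x, of _ 2 1] P_sym[OF x, of 2 1] algebra_simps)
  \<comment> \<open>By \<open>partial_Y\<close>, \<epsilon>^12 times the summand's coefficient is
    \<nabla>_d Y_c; the symmetric \<sigma>^cd keeps only its symmetric part Z.\<close>
  hence "\<epsilon> 1 2 x * (- (\<Sum>c\<in>UNIV. \<Sum>d\<in>UNIV. (partial d (curlP c) x - (\<Sum>e\<in>UNIV. \<Gamma> e d e x) * curlP c x
      - (\<Sum>e\<in>UNIV. \<Gamma> e d c x * curlP e x)) * \<sigma> c d x) - 5 * (\<Sum>c\<in>UNIV. curlP c x * \<mu> c x)) = 0"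
    by simp
  thus ?thesis
    by (simp add: Z2_def symm_def cov1_def partial_Y[OF x] Y_eq_curlP[OF x] sum_2 \<sigma>_sym[OF x, of 2 1]
       \<Gamma>_sym[OF x, of _ 2 1] field_simps)
qed

text \<open>The derivative of \<sigma> in the Z term contributes 2 Z_ac \<mu>^c, which completes S.
  The derivative of \<mu> contributes 5 Y_a \<rho> and -5 P_ad Y_c \<sigma>^cd, which completes V
  after symmetrisation in c, d.\<close>

lemma constraint_deriv:
  assumes x: "x \<in> S"
  shows "(\<Sum>c\<in>UNIV. \<Sum>d\<in>UNIV. N a c d x * \<sigma> c d x) + (\<Sum>c\<in>UNIV. M a c x * \<mu> c x) + 5 * (Y a x * \<rho> x) = 0"
proof -
  have "0 = partial a (\<lambda>x. (\<Sum>c\<in>UNIV. \<Sum>d\<in>UNIV. Z c d x * \<sigma> c d x) + 5 * (\<Sum>c\<in>UNIV. Y c x * \<mu> c x)) x"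
    using partial_cong[OF open_S x constraint, where a = a] by simp
  also have "\<dots> = partial a (\<lambda>x. \<Sum>c\<in>UNIV. \<Sum>d\<in>UNIV. Z c d x * \<sigma> c d x) x
      + 5 * partial a (\<lambda>x. \<Sum>c\<in>UNIV. Y c x * \<mu> c x) x"
    using x by (simp add: partial_S diff_S smooth_sol)
  also have "\<dots> = (\<Sum>c\<in>UNIV. \<Sum>d\<in>UNIV. N a c d x * \<sigma> c d x) + (\<Sum>c\<in>UNIV. M a c x * \<mu> c x) + 5 * (Y a x * \<rho> x)"
    unfolding partial_contract[OF smooth_Z smooth_\<sigma> x] partial_contract1[OF smooth_Y smooth_\<mu> x]
    using exhaust_2[of a] x
    by (elim disjE; simp add: cov_\<sigma> cov_\<mu> N_eq M_eq
      kdelta_def sum_2 Z_sym[of 2 1] \<sigma>_sym[OF x, of 2 1] field_simps)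
  finally show ?thesis by simp
qed

lemma constraint_deriv2:
  assumes x: "x \<in> S"
  shows "(\<Sum>c\<in>UNIV. \<Sum>d\<in>UNIV. cov3 \<Gamma> N b a c d x * \<sigma> c d x + N a c d x * cov_bivector \<Gamma> \<sigma> b c d x)
     + (\<Sum>c\<in>UNIV. cov2 \<Gamma> M b a c x * \<mu> c x + M a c x * cov_vector \<Gamma> \<mu> b c x)
     + 5 * (cov1 \<Gamma> Y b a x * \<rho> x + Y a x * partial b \<rho> x) = 0"
proof -
  let ?K = "\<lambda>a x. (\<Sum>c\<in>UNIV. \<Sum>d\<in>UNIV. N a c d x * \<sigma> c d x) + (\<Sum>c\<in>UNIV. M a c x * \<mu> c x) + 5 * (Y a x * \<rho> x)"
  have "0 = partial b (?K a) x"
    using partial_cong[OF open_S x constraint_deriv[of _ a], where a = b] by simp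
  also have "\<dots> = partial b (\<lambda>x. \<Sum>c\<in>UNIV. \<Sum>d\<in>UNIV. N a c d x * \<sigma> c d x) x
      + partial b (\<lambda>x. \<Sum>c\<in>UNIV. M a c x * \<mu> c x) x
      + 5 * (partial b (Y a) x * \<rho> x + Y a x * partial b \<rho> x)"
    using x by (simp add: partial_S diff_S smooth_sol smooth_N smooth_M)
  \<comment> \<open>Subtracting the symbols times the constraint itself, which is zero, turns the
    partial derivative of the covector \<open>?K\<close> into a covariant one.\<close>
  finally have "0 = partial b (\<lambda>x. \<Sum>c\<in>UNIV. \<Sum>d\<in>UNIV. N a c d x * \<sigma> c d x) x
      + partial b (\<lambda>x. \<Sum>c\<in>UNIV. M a c x * \<mu> c x) x
      + 5 * (partial b (Y a) x * \<rho> x + Y a x * partial b \<rho> x)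
      - (\<Sum>e\<in>UNIV. \<Gamma> e b a x * ?K e x)"
    by (simp add: constraint_deriv[OF x])
  thus ?thesis
    unfolding partial_contract[OF smooth_N smooth_\<sigma> x] partial_contract1[OF smooth_M smooth_\<mu> x]
      cov3_slice[of N] cov2_slice[of M]
    by (simp add: cov1_def sum_2 algebra_simps)
qed

lemma partial_\<rho>:
  assumes x: "x \<in> S"
  shows "partial a \<rho> x = - 2 * (\<Sum>b\<in>UNIV. P a b x * \<mu> b x)
    + 2 * (\<Sum>c\<in>UNIV. \<Sum>d\<in>UNIV. Y3 \<Gamma> P a c d x * \<sigma> c d x)"
  using exhaust_2[of a]
  by (elim disjE; simp add: partial_\<rho>_1[OF x] partial_\<rho>_2[OF x] curlP_def Y3_def sum_2 algebra_simps)

text \<open>Averages \<open>constraint_deriv2\<close> over the two orders of a, b; nothing is lost,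
  since the Hessian of a scalar is symmetric. In the coefficient of \<rho>, the term M gives 5 + 2
  and the derivative of 5 Y gives 5, hence Q = 12 Z.\<close>

lemma constraint_deriv2_sym:
  assumes x: "x \<in> S"
  shows "(\<Sum>c\<in>UNIV. \<Sum>d\<in>UNIV. X_ten \<Gamma> \<epsilon> P c d a b x * \<sigma> c d x)
     + (\<Sum>c\<in>UNIV. T_ten \<Gamma> \<epsilon> P c a b x * \<mu> c x) + Q_ten \<Gamma> \<epsilon> P a b x * \<rho> x = 0"
proof -
  note eq = constraint_deriv2[OF x, unfolded cov_N[OF x] cov_M[OF x] cov_\<sigma>[OF x] cov_\<mu>[OF x] partial_\<rho>[OF x]]
  show ?thesis
    using eq[of a b] eq[of b a] exhaust_2[of a] exhaust_2[of b]
    by (elim disjE; simp add: X_ten_def T_ten_def Q_ten_def M_eq N_eq symm_def kdelta_def sum_2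
        \<sigma>_sym[OF x, of 2 1] P_sym[OF x, of 2 1] Z_eq cov2_Z_sym[of _ 2 1]
        algebra_simps add_divide_distrib diff_divide_distrib)
qed

end


section \<open>The obstruction as a determinant\<close>

text \<open>In dimension two, contraction with a skew bivector \<open>\<epsilon>\<^bsup>ab\<^esup>\<close> is \<open>\<epsilon>\<^bsup>12\<^esup>\<close> times \<open>alt\<close>.\<close>

definition alt :: "(2 \<Rightarrow> 2 \<Rightarrow> real) \<Rightarrow> real" where
  "alt F = F 1 2 - F 2 1"

definition wedge :: "(2 \<Rightarrow> real) \<Rightarrow> (2 \<Rightarrow> real) \<Rightarrow> real" where
  "wedge u v = u 1 * v 2 - u 2 * v 1"

section \<open>Singularity of a 6 by 6 matrix through 3 by 3 minors\<close>

type_synonym triplet = "real \<times> real \<times> real"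

fun triple :: "triplet \<Rightarrow> triplet \<Rightarrow> triplet \<Rightarrow> real" where
  "triple (a1, a2, a3) (b1, b2, b3) (c1, c2, c3)
     = a1 * (b2 * c3 - b3 * c2) - a2 * (b1 * c3 - b3 * c1) + a3 * (b1 * c2 - b2 * c1)"

text \<open>For one unknown, the lower half of its column: its coefficients in the three independent
  equations (a,b) = (1,1), (1,2), (2,2) of the symmetrised second derivative.\<close>

definition col :: "(2 \<Rightarrow> 2 \<Rightarrow> real) \<Rightarrow> triplet" where
  "col F = (F 1 1, F 1 2, F 2 2)"

text \<open>The determinant of the matrix whose columns are the \<open>k\<^sub>i\<close> stacked on the \<open>l\<^sub>i\<close>, by Laplace expansion.\<close>

definition laplace :: "triplet \<Rightarrow> triplet \<Rightarrow> triplet \<Rightarrow> triplet \<Rightarrow> triplet \<Rightarrow> triplet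
    \<Rightarrow> triplet \<Rightarrow> triplet \<Rightarrow> triplet \<Rightarrow> triplet \<Rightarrow> triplet \<Rightarrow> triplet \<Rightarrow> real" where
  "laplace k0 k1 k2 k3 k4 k5 l0 l1 l2 l3 l4 l5 =
     triple k0 k1 k2 * triple l3 l4 l5
     - triple k0 k1 k3 * triple l2 l4 l5
     + triple k0 k1 k4 * triple l2 l3 l5
     - triple k0 k1 k5 * triple l2 l3 l4
     + triple k0 k2 k3 * triple l1 l4 l5
     - triple k0 k2 k4 * triple l1 l3 l5
     + triple k0 k2 k5 * triple l1 l3 l4
     + triple k0 k3 k4 * triple l1 l2 l5
     - triple k0 k3 k5 * triple l1 l2 l4
     + triple k0 k4 k5 * triple l1 l2 l3
     - triple k1 k2 k3 * triple l0 l4 l5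
     + triple k1 k2 k4 * triple l0 l3 l5
     - triple k1 k2 k5 * triple l0 l3 l4
     - triple k1 k3 k4 * triple l0 l2 l5
     + triple k1 k3 k5 * triple l0 l2 l4
     - triple k1 k4 k5 * triple l0 l2 l3
     + triple k2 k3 k4 * triple l0 l1 l5
     - triple k2 k3 k5 * triple l0 l1 l4
     + triple k2 k4 k5 * triple l0 l1 l3
     - triple k3 k4 k5 * triple l0 l1 l2"

text \<open>Linearity in the first column lets the kernel relation replace \<open>k0\<close> by the
  other columns.\<close>

lemma triple_kernel:
  assumes "v0 *\<^sub>R k0 + v1 *\<^sub>R k1 + v2 *\<^sub>R k2 + v3 *\<^sub>R k3 + v4 *\<^sub>R k4 + v5 *\<^sub>R k5 = 0"
  shows "v0 * triple k0 b c = - (v1 * triple k1 b c + v2 * triple k2 b c + v3 * triple k3 b c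
    + v4 * triple k4 b c + v5 * triple k5 b c)"
proof -
  have "triple (v0 *\<^sub>R k0 + v1 *\<^sub>R k1 + v2 *\<^sub>R k2 + v3 *\<^sub>R k3 + v4 *\<^sub>R k4 + v5 *\<^sub>R k5) b c
     = v0 * triple k0 b c + v1 * triple k1 b c + v2 * triple k2 b c + v3 * triple k3 b c
    + v4 * triple k4 b c + v5 * triple k5 b c"
    by (cases k0; cases k1; cases k2; cases k3; cases k4; cases k5; cases b; cases c)
      (simp add: algebra_simps)
  moreover have "triple 0 b c = 0"
    by (cases b; cases c) (simp add: zero_prod_def)
  ultimately show ?thesis using assms by simp
qed

lemma triple_alternating:
  "triple a a c = 0" "triple a b a = 0" "triple a b c = - triple b a c" "triple a b c = triple b c a"
  by (cases a; cases b; cases c; simp add: algebra_simps)+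

text \<open>Each product in the expansion has exactly one minor involving column 0. Multiplied by
  \<open>v0\<close>, that minor becomes a combination of minors of columns 1 to 5, and the resulting
  terms cancel in pairs.\<close>

lemma laplace_kernel:
  assumes K: "v0 *\<^sub>R k0 + v1 *\<^sub>R k1 + v2 *\<^sub>R k2 + v3 *\<^sub>R k3 + v4 *\<^sub>R k4 + v5 *\<^sub>R k5 = 0"
    and L: "v0 *\<^sub>R l0 + v1 *\<^sub>R l1 + v2 *\<^sub>R l2 + v3 *\<^sub>R l3 + v4 *\<^sub>R l4 + v5 *\<^sub>R l5 = 0"
    and nz: "v0 \<noteq> 0"
  shows "laplace k0 k1 k2 k3 k4 k5 l0 l1 l2 l3 l4 l5 = 0"
proof -
  have minors:
    "v0 * triple k0 k1 k2 = - v3 * triple k1 k2 k3  - v4 * triple k1 k2 k4  - v5 * triple k1 k2 k5"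
    "v0 * triple k0 k1 k3 = v2 * triple k1 k2 k3  - v4 * triple k1 k3 k4  - v5 * triple k1 k3 k5"
    "v0 * triple k0 k1 k4 = v2 * triple k1 k2 k4  + v3 * triple k1 k3 k4  - v5 * triple k1 k4 k5"
    "v0 * triple k0 k1 k5 = v2 * triple k1 k2 k5  + v3 * triple k1 k3 k5  + v4 * triple k1 k4 k5"
    "v0 * triple k0 k2 k3 = - v1 * triple k1 k2 k3  - v4 * triple k2 k3 k4  - v5 * triple k2 k3 k5"
    "v0 * triple k0 k2 k4 = - v1 * triple k1 k2 k4  + v3 * triple k2 k3 k4  - v5 * triple k2 k4 k5"
    "v0 * triple k0 k2 k5 = - v1 * triple k1 k2 k5  + v3 * triple k2 k3 k5  + v4 * triple k2 k4 k5"
    "v0 * triple k0 k3 k4 = - v1 * triple k1 k3 k4  - v2 * triple k2 k3 k4  - v5 * triple k3 k4 k5"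
    "v0 * triple k0 k3 k5 = - v1 * triple k1 k3 k5  - v2 * triple k2 k3 k5  + v4 * triple k3 k4 k5"
    "v0 * triple k0 k4 k5 = - v1 * triple k1 k4 k5  - v2 * triple k2 k4 k5  - v3 * triple k3 k4 k5"
    "v0 * triple l0 l1 l2 = - v3 * triple l1 l2 l3  - v4 * triple l1 l2 l4  - v5 * triple l1 l2 l5"
    "v0 * triple l0 l1 l3 = v2 * triple l1 l2 l3  - v4 * triple l1 l3 l4  - v5 * triple l1 l3 l5"
    "v0 * triple l0 l1 l4 = v2 * triple l1 l2 l4  + v3 * triple l1 l3 l4  - v5 * triple l1 l4 l5"
    "v0 * triple l0 l1 l5 = v2 * triple l1 l2 l5  + v3 * triple l1 l3 l5  + v4 * triple l1 l4 l5"
    "v0 * triple l0 l2 l3 = - v1 * triple l1 l2 l3  - v4 * triple l2 l3 l4  - v5 * triple l2 l3 l5"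
    "v0 * triple l0 l2 l4 = - v1 * triple l1 l2 l4  + v3 * triple l2 l3 l4  - v5 * triple l2 l4 l5"
    "v0 * triple l0 l2 l5 = - v1 * triple l1 l2 l5  + v3 * triple l2 l3 l5  + v4 * triple l2 l4 l5"
    "v0 * triple l0 l3 l4 = - v1 * triple l1 l3 l4  - v2 * triple l2 l3 l4  - v5 * triple l3 l4 l5"
    "v0 * triple l0 l3 l5 = - v1 * triple l1 l3 l5  - v2 * triple l2 l3 l5  + v4 * triple l3 l4 l5"
    "v0 * triple l0 l4 l5 = - v1 * triple l1 l4 l5  - v2 * triple l2 l4 l5  - v3 * triple l3 l4 l5"
    using triple_kernel[OF K] triple_kernel[OF L]
    \<comment> \<open>\<open>triple_kernel\<close> leaves the new column in front; these instances
      sort the columns of each minor.\<close>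
    by (simp_all add: triple_alternating(1,2) triple_alternating(3)[of k2 k1 k3]
      triple_alternating(4)[of k3 k1 k2]
      triple_alternating(3)[of k2 k1 k4]
      triple_alternating(4)[of k4 k1 k2]
      triple_alternating(3)[of k2 k1 k5]
      triple_alternating(4)[of k5 k1 k2]
      triple_alternating(3)[of k3 k1 k4]
      triple_alternating(4)[of k4 k1 k3]
      triple_alternating(3)[of k3 k1 k5]
      triple_alternating(4)[of k5 k1 k3]
      triple_alternating(3)[of k4 k1 k5]
      triple_alternating(4)[of k5 k1 k4]
      triple_alternating(3)[of k3 k2 k4]
      triple_alternating(4)[of k4 k2 k3]
      triple_alternating(3)[of k3 k2 k5]
      triple_alternating(4)[of k5 k2 k3]
      triple_alternating(3)[of k4 k2 k5]
      triple_alternating(4)[of k5 k2 k4]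
      triple_alternating(3)[of k4 k3 k5]
      triple_alternating(4)[of k5 k3 k4]
      triple_alternating(3)[of l2 l1 l3]
      triple_alternating(4)[of l3 l1 l2]
      triple_alternating(3)[of l2 l1 l4]
      triple_alternating(4)[of l4 l1 l2]
      triple_alternating(3)[of l2 l1 l5]
      triple_alternating(4)[of l5 l1 l2]
      triple_alternating(3)[of l3 l1 l4]
      triple_alternating(4)[of l4 l1 l3]
      triple_alternating(3)[of l3 l1 l5]
      triple_alternating(4)[of l5 l1 l3]
      triple_alternating(3)[of l4 l1 l5]
      triple_alternating(4)[of l5 l1 l4]
      triple_alternating(3)[of l3 l2 l4]
      triple_alternating(4)[of l4 l2 l3]
      triple_alternating(3)[of l3 l2 l5]
      triple_alternating(4)[of l5 l2 l3]
      triple_alternating(3)[of l4 l2 l5]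
      triple_alternating(4)[of l5 l2 l4]
      triple_alternating(3)[of l4 l3 l5]
      triple_alternating(4)[of l5 l3 l4])
  have "v0 * laplace k0 k1 k2 k3 k4 k5 l0 l1 l2 l3 l4 l5 =
     (v0 * triple k0 k1 k2) * triple l3 l4 l5
     - (v0 * triple k0 k1 k3) * triple l2 l4 l5
     + (v0 * triple k0 k1 k4) * triple l2 l3 l5
     - (v0 * triple k0 k1 k5) * triple l2 l3 l4
     + (v0 * triple k0 k2 k3) * triple l1 l4 l5
     - (v0 * triple k0 k2 k4) * triple l1 l3 l5
     + (v0 * triple k0 k2 k5) * triple l1 l3 l4
     + (v0 * triple k0 k3 k4) * triple l1 l2 l5
     - (v0 * triple k0 k3 k5) * triple l1 l2 l4
     + (v0 * triple k0 k4 k5) * triple l1 l2 l3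
     - triple k1 k2 k3 * (v0 * triple l0 l4 l5)
     + triple k1 k2 k4 * (v0 * triple l0 l3 l5)
     - triple k1 k2 k5 * (v0 * triple l0 l3 l4)
     - triple k1 k3 k4 * (v0 * triple l0 l2 l5)
     + triple k1 k3 k5 * (v0 * triple l0 l2 l4)
     - triple k1 k4 k5 * (v0 * triple l0 l2 l3)
     + triple k2 k3 k4 * (v0 * triple l0 l1 l5)
     - triple k2 k3 k5 * (v0 * triple l0 l1 l4)
     + triple k2 k4 k5 * (v0 * triple l0 l1 l3)
     - triple k3 k4 k5 * (v0 * triple l0 l1 l2)"
    by (simp add: laplace_def algebra_simps)
  also have "\<dots> = 0"
    unfolding minors by (simp add: algebra_simps)
  finally show ?thesis using nz by simp
qed

text \<open>Allows column 1 to take the role of the pivot column when the first unknown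
  vanishes.\<close>

lemma laplace_swap:
  "laplace k1 k0 k2 k3 k4 k5 l1 l0 l2 l3 l4 l5 = - laplace k0 k1 k2 k3 k4 k5 l0 l1 l2 l3 l4 l5"
  unfolding laplace_def
  by (simp add: triple_alternating(3)[of k1 k0] triple_alternating(3)[of l1 l0] algebra_simps)

section \<open>Contractions with eight copies of the skew bivector\<close>

abbreviation "alt8 F \<equiv> alt (\<lambda>a b. alt (\<lambda>c d. alt (\<lambda>e f. alt (\<lambda>g h.
    alt (\<lambda>i j. alt (\<lambda>k l. alt (\<lambda>m n. alt (\<lambda>p q. F a b c d e f g h i j k l m n p q))))))))"

lemma alt_linear:
  "alt (\<lambda>a b. F a b + G a b) = alt F + alt G" "alt (\<lambda>a b. F a b - G a b) = alt F - alt G"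
  "alt (\<lambda>a b. c * F a b) = c * alt F"
  by (simp_all add: alt_def algebra_simps)

lemma sum_alt:
  assumes "\<And>a b. E a b = - E b a"
  shows "(\<Sum>a\<in>UNIV. \<Sum>b\<in>UNIV. E a b * F a b) = E 1 2 * alt F"
  using assms[of 1 1] assms[of 2 2] assms[of 2 1] by (simp add: sum_2 alt_def algebra_simps)

lemma sum_alt8:
  assumes "\<And>a b. E a b = - E b a"
  shows "(\<Sum>a\<in>UNIV. \<Sum>b\<in>UNIV. \<Sum>c\<in>UNIV. \<Sum>d\<in>UNIV. \<Sum>e\<in>UNIV. \<Sum>f\<in>UNIV. \<Sum>g\<in>UNIV. \<Sum>h\<in>UNIV.
      \<Sum>i\<in>UNIV. \<Sum>j\<in>UNIV. \<Sum>k\<in>UNIV. \<Sum>l\<in>UNIV. \<Sum>m\<in>UNIV. \<Sum>n\<in>UNIV. \<Sum>p\<in>UNIV. \<Sum>q\<in>UNIV.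
      E a b * E c d * E e f * E g h * E i j * E k l * E m n * E p q * F a b c d e f g h i j k l m n p q)
    = (E 1 2) ^ 8 * alt8 F"
  by (simp only: mult.assoc sum_distrib_left[symmetric] sum_alt[of E, OF assms] alt_linear(3))
    (simp add: eval_nat_numeral mult.assoc)

text \<open>At a fixed point the tensors are arrays of reals. Their index symmetries reduce every
  entry to sorted indices, after which each contraction is a polynomial identity.\<close>

locale prolonged_coefficients =
  fixes P R :: "2 \<Rightarrow> real" and Q S U :: "2 \<Rightarrow> 2 \<Rightarrow> real"
    and T V :: "2 \<Rightarrow> 2 \<Rightarrow> 2 \<Rightarrow> real" and X :: "2 \<Rightarrow> 2 \<Rightarrow> 2 \<Rightarrow> 2 \<Rightarrow> real"
  assumes Q_sym: "Q a b = Q b a" and T_sym: "T c a b = T c b a" and U_sym: "U a b = U b a"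
    and V_sym: "V a b c = V b a c"
    and X_sym1: "X c d a b = X d c a b" and X_sym2: "X c d a b = X c d b a"
begin

text \<open>The nine contractions in the obstruction are the nine types of products in the Laplace expansion
  of the determinant whose minors of the first three rows are expanded further along the first row.\<close>

lemma contraction_1:
  "alt8 (\<lambda>a b c d e f g h i j k l m n p q.
        Q g i * S m p * T n j k * U a c * V d e q * X b f h l)
    = U 1 1 * wedge (V 1 2) (S 1) * triple (col (X 2 2)) (col (T 2)) (col Q)
     - U 1 2 * wedge (V 1 1) (S 1) * triple (col (X 2 2)) (col (T 2)) (col Q)
     - U 1 1 * wedge (V 1 2) (S 2) * triple (col (X 2 2)) (col (T 1)) (col Q)
     + U 1 2 * wedge (V 1 1) (S 2) * triple (col (X 2 2)) (col (T 1)) (col Q)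
     - U 1 1 * wedge (V 2 2) (S 1) * triple (col (X 1 2)) (col (T 2)) (col Q)
     + U 2 2 * wedge (V 1 1) (S 1) * triple (col (X 1 2)) (col (T 2)) (col Q)
     + U 1 1 * wedge (V 2 2) (S 2) * triple (col (X 1 2)) (col (T 1)) (col Q)
     - U 2 2 * wedge (V 1 1) (S 2) * triple (col (X 1 2)) (col (T 1)) (col Q)
     + U 1 2 * wedge (V 2 2) (S 1) * triple (col (X 1 1)) (col (T 2)) (col Q)
     - U 2 2 * wedge (V 1 2) (S 1) * triple (col (X 1 1)) (col (T 2)) (col Q)
     - U 1 2 * wedge (V 2 2) (S 2) * triple (col (X 1 1)) (col (T 1)) (col Q)
     + U 2 2 * wedge (V 1 2) (S 2) * triple (col (X 1 1)) (col (T 1)) (col Q)"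
  unfolding alt_def wedge_def triple.simps col_def
    Q_sym[of 2 1] T_sym[of _ 2 1] U_sym[of 2 1] V_sym[of 2 1] X_sym1[of 2 1] X_sym2[of _ _ 2 1]
  by algebra

lemma contraction_2:
  "alt8 (\<lambda>a b c d e f g h i j k l m n p q.
        P p * R m * S n q * X a c g i * X b e h k * X d f j l)
    = 6 * (- R 1 * wedge (S 2) P * triple (col (X 1 1)) (col (X 1 2)) (col (X 2 2))
     + R 2 * wedge (S 1) P * triple (col (X 1 1)) (col (X 1 2)) (col (X 2 2)))"
  unfolding alt_def wedge_def triple.simps col_def
    X_sym1[of 2 1] X_sym2[of _ _ 2 1]
  by algebra

lemma contraction_3:
  "alt8 (\<lambda>a b c d e f g h i j k l m n p q.
        P p * S m q * T n j l * U c e * X a d g k * X b f h i)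
    = 2 * (- U 1 1 * wedge (S 1) P * triple (col (X 1 2)) (col (X 2 2)) (col (T 2))
     + U 1 1 * wedge (S 2) P * triple (col (X 1 2)) (col (X 2 2)) (col (T 1))
     + U 1 2 * wedge (S 1) P * triple (col (X 1 1)) (col (X 2 2)) (col (T 2))
     - U 1 2 * wedge (S 2) P * triple (col (X 1 1)) (col (X 2 2)) (col (T 1))
     - U 2 2 * wedge (S 1) P * triple (col (X 1 1)) (col (X 1 2)) (col (T 2))
     + U 2 2 * wedge (S 2) P * triple (col (X 1 1)) (col (X 1 2)) (col (T 1)))"
  unfolding alt_def wedge_def triple.simps col_def
    T_sym[of _ 2 1] U_sym[of 2 1] X_sym1[of 2 1] X_sym2[of _ _ 2 1]
  by algebra

lemma contraction_4:
  "alt8 (\<lambda>a b c d e f g h i j k l m n p q.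
        P p * T m g i * T n j k * U a c * V d e q * X b f h l)
    = 2 * (- U 1 1 * wedge (V 1 2) P * triple (col (X 2 2)) (col (T 1)) (col (T 2))
     + U 1 2 * wedge (V 1 1) P * triple (col (X 2 2)) (col (T 1)) (col (T 2))
     + U 1 1 * wedge (V 2 2) P * triple (col (X 1 2)) (col (T 1)) (col (T 2))
     - U 2 2 * wedge (V 1 1) P * triple (col (X 1 2)) (col (T 1)) (col (T 2))
     - U 1 2 * wedge (V 2 2) P * triple (col (X 1 1)) (col (T 1)) (col (T 2))
     + U 2 2 * wedge (V 1 2) P * triple (col (X 1 1)) (col (T 1)) (col (T 2)))"
  unfolding alt_def wedge_def triple.simps col_def
    T_sym[of _ 2 1] U_sym[of 2 1] V_sym[of 2 1] X_sym1[of 2 1] X_sym2[of _ _ 2 1]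
  by algebra

lemma contraction_5:
  "alt8 (\<lambda>a b c d e f g h i j k l m n p q.
        P p * R m * T n g i * V a c q * X d e j k * X b f h l)
    = 2 * (- R 1 * wedge (V 1 1) P * triple (col (X 1 2)) (col (X 2 2)) (col (T 2))
     + R 2 * wedge (V 1 1) P * triple (col (X 1 2)) (col (X 2 2)) (col (T 1))
     + R 1 * wedge (V 1 2) P * triple (col (X 1 1)) (col (X 2 2)) (col (T 2))
     - R 2 * wedge (V 1 2) P * triple (col (X 1 1)) (col (X 2 2)) (col (T 1))
     - R 1 * wedge (V 2 2) P * triple (col (X 1 1)) (col (X 1 2)) (col (T 2))
     + R 2 * wedge (V 2 2) P * triple (col (X 1 1)) (col (X 1 2)) (col (T 1)))"
  unfolding alt_def wedge_def triple.simps col_def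
    T_sym[of _ 2 1] V_sym[of 2 1] X_sym1[of 2 1] X_sym2[of _ _ 2 1]
  by algebra

lemma contraction_6:
  "alt8 (\<lambda>a b c d e f g h i j k l m n p q.
        Q g i * R m * S n p * V a c q * X d e j k * X b f h l)
    = 2 * (- R 1 * wedge (V 1 1) (S 2) * triple (col (X 1 2)) (col (X 2 2)) (col Q)
     + R 2 * wedge (V 1 1) (S 1) * triple (col (X 1 2)) (col (X 2 2)) (col Q)
     + R 1 * wedge (V 1 2) (S 2) * triple (col (X 1 1)) (col (X 2 2)) (col Q)
     - R 2 * wedge (V 1 2) (S 1) * triple (col (X 1 1)) (col (X 2 2)) (col Q)
     - R 1 * wedge (V 2 2) (S 2) * triple (col (X 1 1)) (col (X 1 2)) (col Q)
     + R 2 * wedge (V 2 2) (S 1) * triple (col (X 1 1)) (col (X 1 2)) (col Q))"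
  unfolding alt_def wedge_def triple.simps col_def
    Q_sym[of 2 1] V_sym[of 2 1] X_sym1[of 2 1] X_sym2[of _ _ 2 1]
  by algebra

lemma contraction_7:
  "alt8 (\<lambda>a b c d e f g h i j k l m n p q.
        Q g i * R m * T n j k * V a c p * V d e q * X b f h l)
    = 2 * (- R 1 * wedge (V 1 1) (V 1 2) * triple (col (X 2 2)) (col (T 2)) (col Q)
     + R 2 * wedge (V 1 1) (V 1 2) * triple (col (X 2 2)) (col (T 1)) (col Q)
     + R 1 * wedge (V 1 1) (V 2 2) * triple (col (X 1 2)) (col (T 2)) (col Q)
     - R 2 * wedge (V 1 1) (V 2 2) * triple (col (X 1 2)) (col (T 1)) (col Q)
     - R 1 * wedge (V 1 2) (V 2 2) * triple (col (X 1 1)) (col (T 2)) (col Q)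
     + R 2 * wedge (V 1 2) (V 2 2) * triple (col (X 1 1)) (col (T 1)) (col Q))"
  unfolding alt_def wedge_def triple.simps col_def
    Q_sym[of 2 1] T_sym[of _ 2 1] V_sym[of 2 1] X_sym1[of 2 1] X_sym2[of _ _ 2 1]
  by algebra

lemma contraction_8:
  "alt8 (\<lambda>a b c d e f g h i j k l m n p q.
        Q g i * S m p * S n q * U a c * X d e j k * X b f h l)
    = 4 * (U 1 1 * wedge (S 1) (S 2) * triple (col (X 1 2)) (col (X 2 2)) (col Q)
     - U 1 2 * wedge (S 1) (S 2) * triple (col (X 1 1)) (col (X 2 2)) (col Q)
     + U 2 2 * wedge (S 1) (S 2) * triple (col (X 1 1)) (col (X 1 2)) (col Q))"
  unfolding alt_def wedge_def triple.simps col_def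
    Q_sym[of 2 1] U_sym[of 2 1] X_sym1[of 2 1] X_sym2[of _ _ 2 1]
  by algebra

lemma contraction_9:
  "alt8 (\<lambda>a b c d e f g h i j k l m n p q.
        Q g i * T m j k * T n h l * U a c * V d e p * V b f q)
    = 4 * (U 1 1 * wedge (V 1 2) (V 2 2) * triple (col (T 1)) (col (T 2)) (col Q)
     - U 1 2 * wedge (V 1 1) (V 2 2) * triple (col (T 1)) (col (T 2)) (col Q)
     + U 2 2 * wedge (V 1 1) (V 1 2) * triple (col (T 1)) (col (T 2)) (col Q))"
  unfolding alt_def wedge_def triple.simps col_def
    Q_sym[of 2 1] T_sym[of _ 2 1] U_sym[of 2 1] V_sym[of 2 1]
  by algebra

text \<open>The columns belong to the unknowns \<sigma>^11, 2 \<sigma>^12, \<sigma>^22, \<mu>^1,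
  \<mu>^2, \<rho> in this order. The entry 0 reflects that \<rho> is absent from the
  undifferentiated constraint.\<close>

lemma contraction_laplace:
  "alt8 (\<lambda>a b c d e f g h i j k l m n p q.
        Q g i * S m p * T n j k * U a c * V d e q * X b f h l
        - (1/6) * P p * R m * S n q * X a c g i * X b e h k * X d f j l
        - (1/2) * P p * S m q * T n j l * U c e * X a d g k * X b f h i
        - (1/2) * P p * T m g i * T n j k * U a c * V d e q * X b f h l
        + (1/2) * P p * R m * T n g i * V a c q * X d e j k * X b f h l
        - (1/2) * Q g i * R m * S n p * V a c q * X d e j k * X b f h l
        - (1/2) * Q g i * R m * T n j k * V a c p * V d e q * X b f h l
        - (1/4) * Q g i * S m p * S n q * U a c * X d e j k * X b f h l
        - (1/4) * Q g i * T m j k * T n h l * U a c * V d e p * V b f q)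
    = - laplace (U 1 1, V 1 1 1, V 1 1 2) (U 1 2, V 1 2 1, V 1 2 2) (U 2 2, V 2 2 1, V 2 2 2)
      (R 1, S 1 1, S 1 2) (R 2, S 2 1, S 2 2) (0, P 1, P 2)
      (col (X 1 1)) (col (X 1 2)) (col (X 2 2)) (col (T 1)) (col (T 2)) (col Q)"
  (is "?contraction = - ?laplace")
proof -
  have "?contraction
    = alt8 (\<lambda>a b c d e f g h i j k l m n p q.
        Q g i * S m p * T n j k * U a c * V d e q * X b f h l)
      - (1/6) * alt8 (\<lambda>a b c d e f g h i j k l m n p q.
        P p * R m * S n q * X a c g i * X b e h k * X d f j l)
      - (1/2) * alt8 (\<lambda>a b c d e f g h i j k l m n p q.
        P p * S m q * T n j l * U c e * X a d g k * X b f h i)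
      - (1/2) * alt8 (\<lambda>a b c d e f g h i j k l m n p q.
        P p * T m g i * T n j k * U a c * V d e q * X b f h l)
      + (1/2) * alt8 (\<lambda>a b c d e f g h i j k l m n p q.
        P p * R m * T n g i * V a c q * X d e j k * X b f h l)
      - (1/2) * alt8 (\<lambda>a b c d e f g h i j k l m n p q.
        Q g i * R m * S n p * V a c q * X d e j k * X b f h l)
      - (1/2) * alt8 (\<lambda>a b c d e f g h i j k l m n p q.
        Q g i * R m * T n j k * V a c p * V d e q * X b f h l)
      - (1/4) * alt8 (\<lambda>a b c d e f g h i j k l m n p q.
        Q g i * S m p * S n q * U a c * X d e j k * X b f h l)
      - (1/4) * alt8 (\<lambda>a b c d e f g h i j k l m n p q.
        Q g i * T m j k * T n h l * U a c * V d e p * V b f q)"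
    \<comment> \<open>Only the numerical factors are extracted: with a free constant the rule would
      also pull out tensor factors whose indices are bound further outside.\<close>
    by (simp only: alt_linear(1,2) alt_linear(3)[of "1/6"] alt_linear(3)[of "1/2"] alt_linear(3)[of "1/4"]
        mult.assoc)
  also have "\<dots> = - ?laplace"
    \<comment> \<open>The coefficients 1/6, 1/2 and 1/4 compensate for repeated factors: 3! orders
      of three X, 2 orders of one repeated pair, 4 of two pairs.\<close>
    unfolding contraction_1 contraction_2 contraction_3 contraction_4 contraction_5
      contraction_6 contraction_7 contraction_8 contraction_9
    by (simp add: laplace_def wedge_def algebra_simps)
  finally show ?thesis .
qed

end

context schouten_connection
begin

lemma V_sym: "V_ten \<Gamma> \<epsilon> P c d a x = V_ten \<Gamma> \<epsilon> P d c a x"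
  by (simp add: V_ten_def symm_def cov2_Z_sym[of a c d])

lemma X_sym: "X_ten \<Gamma> \<epsilon> P c d a b x = X_ten \<Gamma> \<epsilon> P d c a b x"
proof -
  have "cov2 \<Gamma> Z a c d = cov2 \<Gamma> Z a d c" for a c d
    by (rule ext) (rule cov2_Z_sym)
  hence "cov3 \<Gamma> (cov2 \<Gamma> Z) a b c d x = cov3 \<Gamma> (cov2 \<Gamma> Z) a b d c x" for a b c d
    by (simp add: cov3_def)
  thus ?thesis by (simp add: X_ten_def symm_def add.commute)
qed

lemma obstruction_laplace:
  assumes x: "x \<in> S"
  defines "p \<equiv> \<lambda>a. P_ten \<Gamma> \<epsilon> P a x" and "q \<equiv> \<lambda>a b. Q_ten \<Gamma> \<epsilon> P a b x"
    and "r \<equiv> \<lambda>c. R_ten \<Gamma> \<epsilon> P c x" and "s \<equiv> \<lambda>c a. S_ten \<Gamma> \<epsilon> P c a x"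
    and "t \<equiv> \<lambda>c a b. T_ten \<Gamma> \<epsilon> P c a b x" and "u \<equiv> \<lambda>c d. U_ten \<Gamma> \<epsilon> P c d x"
    and "v \<equiv> \<lambda>c d a. V_ten \<Gamma> \<epsilon> P c d a x" and "w \<equiv> \<lambda>c d a b. X_ten \<Gamma> \<epsilon> P c d a b x"
  shows "obstruction \<Gamma> \<epsilon> P x = - ((\<epsilon> 1 2 x) ^ 8 * laplace
    (u 1 1, v 1 1 1, v 1 1 2) (u 1 2, v 1 2 1, v 1 2 2) (u 2 2, v 2 2 1, v 2 2 2)
    (r 1, s 1 1, s 1 2) (r 2, s 2 1, s 2 2) (0, p 1, p 2)
    (col (w 1 1)) (col (w 1 2)) (col (w 2 2)) (col (t 1)) (col (t 2)) (col q))"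
proof -
  have Q: "q a b = q b a" for a b
    by (simp add: q_def Q_ten_def Z_sym)
  have T: "t c a b = t c b a" for c a b
    by (simp add: t_def T_ten_def symm_def P_sym[OF x, of a b] add.commute)
  have U: "u a b = u b a" for a b
    by (simp add: u_def U_ten_def Z_sym)
  have V: "v a b c = v b a c" for a b c
    unfolding v_def by (rule V_sym)
  have X12: "w c d a b = w d c a b" for c d a b
    unfolding w_def by (rule X_sym)
  have X34: "w c d a b = w c d b a" for c d a b
    by (simp add: w_def X_ten_def symm_def add.commute)
  interpret coeffs: prolonged_coefficients p r q s u t v w
    by unfold_locales (fact Q T U V X12 X34)+
  have E: "(\<lambda>a b. \<epsilon> a b x) a b = - (\<lambda>a b. \<epsilon> a b x) b a" for a b
    using \<epsilon>_skew[OF x] .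
  show ?thesis
    unfolding obstruction_def Let_def sum_alt8[of "\<lambda>a b. \<epsilon> a b x", OF E]
      p_def[symmetric] q_def[symmetric] r_def[symmetric] s_def[symmetric] t_def[symmetric]
      u_def[symmetric] v_def[symmetric] w_def[symmetric]
    using coeffs.contraction_laplace
    by simp
qed

end

section \<open>Vanishing of the determinant on a nonzero solution\<close>

context metrisability_solution
begin

lemma obstruction_eq_0:
  assumes x: "x \<in> S" and nz: "\<sigma> 1 1 x \<noteq> 0 \<or> \<sigma> 1 2 x \<noteq> 0"
  shows "obstruction \<Gamma> \<epsilon> P x = 0"
proof -
  let ?u = "\<lambda>c d. U_ten \<Gamma> \<epsilon> P c d x" and ?v = "\<lambda>c d a. V_ten \<Gamma> \<epsilon> P c d a x"
    and ?w = "\<lambda>c d a b. X_ten \<Gamma> \<epsilon> P c d a b x" and ?r = "\<lambda>c. R_ten \<Gamma> \<epsilon> P c x"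
    and ?s = "\<lambda>c a. S_ten \<Gamma> \<epsilon> P c a x" and ?t = "\<lambda>c a b. T_ten \<Gamma> \<epsilon> P c a b x"
    and ?p = "\<lambda>a. P_ten \<Gamma> \<epsilon> P a x" and ?q = "\<lambda>a b. Q_ten \<Gamma> \<epsilon> P a b x"
  \<comment> \<open>The off-diagonal component occurs twice in the contractions, hence the unknown 2
    \<sigma>^12.\<close>
  have u: "\<sigma> 1 1 x * ?u 1 1 + (2 * \<sigma> 1 2 x) * ?u 1 2 + \<sigma> 2 2 x * ?u 2 2 + \<mu> 1 x * ?r 1 + \<mu> 2 x * ?r 2 = 0"
    using constraint[OF x]
    by (simp add: sum_2 \<sigma>_sym[OF x, of 2 1] U_ten_def R_ten_def Z_sym[of 2 1] algebra_simps)
  have v: "\<sigma> 1 1 x * ?v 1 1 a + (2 * \<sigma> 1 2 x) * ?v 1 2 a + \<sigma> 2 2 x * ?v 2 2 a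
      + \<mu> 1 x * ?s 1 a + \<mu> 2 x * ?s 2 a + \<rho> x * ?p a = 0" for a
    using constraint_deriv[OF x, of a]
    by (simp add: sum_2 \<sigma>_sym[OF x, of 2 1] V_sym[of 2 1] P_ten_def algebra_simps)
  have w: "\<sigma> 1 1 x * ?w 1 1 a b + (2 * \<sigma> 1 2 x) * ?w 1 2 a b + \<sigma> 2 2 x * ?w 2 2 a b
      + \<mu> 1 x * ?t 1 a b + \<mu> 2 x * ?t 2 a b + \<rho> x * ?q a b = 0" for a b
    using constraint_deriv2_sym[OF x, of a b]
    by (simp add: sum_2 \<sigma>_sym[OF x, of 2 1] X_sym[of 2 1] algebra_simps)
  have K: "\<sigma> 1 1 x *\<^sub>R (?u 1 1, ?v 1 1 1, ?v 1 1 2) + (2 * \<sigma> 1 2 x) *\<^sub>R (?u 1 2, ?v 1 2 1, ?v 1 2 2)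
      + \<sigma> 2 2 x *\<^sub>R (?u 2 2, ?v 2 2 1, ?v 2 2 2) + \<mu> 1 x *\<^sub>R (?r 1, ?s 1 1, ?s 1 2)
      + \<mu> 2 x *\<^sub>R (?r 2, ?s 2 1, ?s 2 2) + \<rho> x *\<^sub>R (0, ?p 1, ?p 2) = 0"
    using u v[of 1] v[of 2] by (simp add: zero_prod_def)
  have L: "\<sigma> 1 1 x *\<^sub>R col (?w 1 1) + (2 * \<sigma> 1 2 x) *\<^sub>R col (?w 1 2) + \<sigma> 2 2 x *\<^sub>R col (?w 2 2)
      + \<mu> 1 x *\<^sub>R col (?t 1) + \<mu> 2 x *\<^sub>R col (?t 2) + \<rho> x *\<^sub>R col ?q = 0"
    using w[of 1 1] w[of 1 2] w[of 2 2] by (simp add: zero_prod_def col_def)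
  have "laplace (?u 1 1, ?v 1 1 1, ?v 1 1 2) (?u 1 2, ?v 1 2 1, ?v 1 2 2) (?u 2 2, ?v 2 2 1, ?v 2 2 2)
    (?r 1, ?s 1 1, ?s 1 2) (?r 2, ?s 2 1, ?s 2 2) (0, ?p 1, ?p 2)
    (col (?w 1 1)) (col (?w 1 2)) (col (?w 2 2)) (col (?t 1)) (col (?t 2)) (col ?q) = 0"
    (is "laplace ?k0 ?k1 ?k2 ?k3 ?k4 ?k5 ?l0 ?l1 ?l2 ?l3 ?l4 ?l5 = 0")
  proof (cases "\<sigma> 1 1 x = 0")
    case False
    thus ?thesis by (rule laplace_kernel[OF K L])
  next
    case True
    hence "2 * \<sigma> 1 2 x \<noteq> 0" using nz by simp
    \<comment> \<open>Commuting the first two summands brings the nonzero unknown 2 \<sigma>^12 to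
      the front.\<close>
    from laplace_kernel[OF K[unfolded add.commute[of "\<sigma> 1 1 x *\<^sub>R _"]]
      L[unfolded add.commute[of "\<sigma> 1 1 x *\<^sub>R _"]] this]
    show ?thesis by (subst (asm) laplace_swap) simp
  qed
  thus ?thesis unfolding obstruction_laplace[OF x] by simp
qed

end


section \<open>Metrics in the projective class\<close>

context special_connection
begin

context
  fixes g :: "2 \<Rightarrow> 2 \<Rightarrow> scalar" and \<omega> :: "2 \<Rightarrow> scalar"
  assumes smooth_g: "\<And>a b. smooth_on S (g a b)" and smooth_\<omega>: "\<And>a. smooth_on S (\<omega> a)"
    and g_sym: "\<And>x a b. x \<in> S \<Longrightarrow> g a b x = g b a x"
    and g_nondeg: "\<And>x. x \<in> S \<Longrightarrow> g 1 1 x * g 2 2 x - g 1 2 x * g 1 2 x \<noteq> 0"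
    and cov_g: "\<And>x a b c. x \<in> S \<Longrightarrow>
      cov2 (\<lambda>c a b x. \<Gamma> c a b x + kdelta c a * \<omega> b x + kdelta c b * \<omega> a x) g a b c x = 0"
begin

definition detg :: scalar where
  "detg x = g 1 1 x * g 2 2 x - g 1 2 x * g 1 2 x"

text \<open>The factor \<open>weight\<close> solves \<open>\<nabla>\<^sub>a (weight det g) = 2 \<omega>\<^sub>a weight det g\<close>, which makes the trace-free
  part of \<open>\<nabla>\<^sub>a sig\<^bsup>bc\<^esup>\<close> vanish, where \<open>sig = weight det g g\<^sup>-\<^sup>1\<close>.\<close>

definition weight :: scalar where
  "weight x = exp (1/3 * ln ((\<epsilon> 1 2 x * inverse (detg x))\<^sup>2))"

definition sig :: "2 \<Rightarrow> 2 \<Rightarrow> scalar" where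
  "sig b c x = weight x * (if b \<noteq> c then - g 1 2 x else if b = 1 then g 2 2 x else g 1 1 x)"

definition mu :: "2 \<Rightarrow> scalar" where
  "mu c x = - (\<Sum>d\<in>UNIV. sig c d x * \<omega> d x)"

lemma partial_g: "x \<in> S \<Longrightarrow> partial a (g b c) x =
    (\<Sum>e\<in>UNIV. (\<Gamma> e a b x + kdelta e a * \<omega> b x + kdelta e b * \<omega> a x) * g e c x)
    + (\<Sum>e\<in>UNIV. (\<Gamma> e a c x + kdelta e a * \<omega> c x + kdelta e c * \<omega> a x) * g b e x)"
  using cov_g[of x a b c] by (simp add: cov2_def)

text \<open>The logarithmic derivative of det g is twice the trace of the metric connection, and the
  projective change adds \<omega> + 2 \<omega> to the trace of the symbols.\<close>

lemma partial_detg: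
  assumes x: "x \<in> S"
  shows "partial a detg x = 2 * ((\<Sum>d\<in>UNIV. \<Gamma> d a d x) + 3 * \<omega> a x) * detg x"
  using x exhaust_2[of a] unfolding detg_def[abs_def]
  by (elim disjE; simp add: partial_S diff_S smooth_S smooth_g partial_g sum_2 kdelta_def
      g_sym[OF x, of 2 1] algebra_simps)

lemma smooth_detg: "smooth_on S detg"
  unfolding detg_def[abs_def] by (intro smooth_S smooth_g)

lemma
  assumes x: "x \<in> S"
  shows differentiable_weight: "weight differentiable at x"
    and partial_weight: "partial a weight x = weight x * (- 2 * (\<Sum>d\<in>UNIV. \<Gamma> d a d x) - 4 * \<omega> a x)"
proof -
  let ?q = "\<lambda>x. \<epsilon> 1 2 x * inverse (detg x)"
  have D: "detg x \<noteq> 0" using g_nondeg[OF x] by (simp add: detg_def)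
  have inv: "(inverse has_real_derivative - (inverse (detg x))\<^sup>2) (at (detg x))"
    using D by (auto intro!: derivative_eq_intros simp: power2_eq_square)
  have dd: "detg differentiable at x" by (rule diff_S[OF smooth_detg x])
  have dinv: "(\<lambda>x. inverse (detg x)) differentiable at x"
    by (rule differentiable_compose[OF inv dd])
  have dq: "?q differentiable at x"
    by (intro differentiable_mult dinv diff_S[OF smooth_\<epsilon> x])
  have pq: "partial a ?q x = ?q x * (- 3 * (\<Sum>d\<in>UNIV. \<Gamma> d a d x) - 6 * \<omega> a x)" for a
    unfolding partial_mult[OF diff_S[OF smooth_\<epsilon> x] dinv] partial_compose[OF inv dd] partial_\<epsilon>[OF x] partial_detg[OF x]
    using D by (simp add: field_simps power2_eq_square)
  have q: "?q x \<noteq> 0" using D \<epsilon>_nonzero[OF x] by simp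
  \<comment> \<open>The function is |t|^(2/3), written through t^2 to admit both signs. The factor
    2/3 turns the logarithmic derivative in \<open>pq\<close> into the one claimed for
    \<open>weight\<close>.\<close>
  have F: "((\<lambda>t. exp (1/3 * ln (t\<^sup>2))) has_real_derivative weight x * (2/3) / ?q x) (at (?q x))"
  proof -
    have "((\<lambda>t. exp (1/3 * ln (t\<^sup>2))) has_real_derivative exp (1/3 * ln (t\<^sup>2)) * (2/3) / t) (at t)"
      if "t \<noteq> 0" for t :: real
      using that zero_less_power2[of t]
      by (auto intro!: derivative_eq_intros simp: field_simps power2_eq_square)
    from this[OF q] show ?thesis by (simp add: weight_def)
  qed
  show "weight differentiable at x"
    using differentiable_compose[OF F dq] by (simp add: weight_def[abs_def])
  have "partial a weight x = weight x * (2/3) / ?q x * partial a ?q x"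
    using partial_compose[OF F dq] by (simp add: weight_def[abs_def])
  thus "partial a weight x = weight x * (- 2 * (\<Sum>d\<in>UNIV. \<Gamma> d a d x) - 4 * \<omega> a x)"
    unfolding pq using q by (simp add: algebra_simps)
qed

lemma smooth_weight: "smooth_on S weight"
  by (rule smooth_on_log_derivative[OF open_S differentiable_weight partial_weight])
    (auto intro!: smooth_S smooth_\<Gamma> smooth_\<omega>)

lemma smooth_sig: "smooth_on S (sig a b)"
  using exhaust_2[of a] exhaust_2[of b]
  by (elim disjE; simp add: sig_def[abs_def] smooth_S smooth_weight smooth_g)

lemma smooth_mu: "smooth_on S (mu a)"
  unfolding mu_def[abs_def] by (intro smooth_S smooth_sig smooth_\<omega>)

lemma sig_sym: "sig a b x = sig b a x"
  by (simp add: sig_def)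

text \<open>For the inverse metric h^bc, compatibility with the changed connection reads \<nabla>_a
  h^bc = -2 \<omega>_a h^bc minus \<open>kdelta b a\<close> h^cd \<omega>_d minus
  \<open>kdelta c a\<close> h^bd \<omega>_d. The rescaling cancels the first term, and
  \<open>mu\<close> collects the rest.\<close>

lemma cov_sig:
  assumes x: "x \<in> S"
  shows "cov_bivector \<Gamma> sig a b c x = kdelta b a * mu c x + kdelta c a * mu b x"
  using x exhaust_2[of a] exhaust_2[of b] exhaust_2[of c]
  by (elim disjE; simp add: sig_def[abs_def] mu_def cov_bivector_def
      partial_S diff_S smooth_S smooth_g smooth_weight partial_weight partial_g sum_2 kdelta_def
      g_sym[OF x, of 2 1] \<Gamma>_sym[OF x, of _ 2 1] algebra_simps)

text \<open>Otherwise g_22 = g_12 = 0, and g would be degenerate. Thus one of the first two unknowns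
  always serves as pivot.\<close>

lemma sig_nonzero:
  assumes x: "x \<in> S"
  shows "sig 1 1 x \<noteq> 0 \<or> sig 1 2 x \<noteq> 0"
  using g_nondeg[OF x] by (auto simp: sig_def weight_def)

lemma ex_metrisability_solution:
  "\<exists>\<sigma> \<mu>. (\<forall>a b. smooth_on S (\<sigma> a b)) \<and> (\<forall>a. smooth_on S (\<mu> a)) \<and> (\<forall>x\<in>S. \<forall>a b. \<sigma> a b x = \<sigma> b a x) \<and>
    (\<forall>x\<in>S. \<forall>a b c. cov_bivector \<Gamma> \<sigma> a b c x = kdelta b a * \<mu> c x + kdelta c a * \<mu> b x) \<and>
    (\<forall>x\<in>S. \<sigma> 1 1 x \<noteq> 0 \<or> \<sigma> 1 2 x \<noteq> 0)"
  using smooth_sig smooth_mu sig_sym cov_sig sig_nonzero by blast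

end

end

section \<open>Passage from the surface to a single chart\<close>

theorem theorem7p3:
  fixes M :: "'m topology" and A :: "'m chart set"
    and \<Gamma> :: "'m connection" and \<epsilon> P :: "'m tensor2"
  assumes "smooth_surface M A"
    and "affine_connection A \<Gamma>" and "torsion_free A \<Gamma>"
    and "volume_bivector A \<epsilon>"
    and "\<forall>\<kappa>\<in>A. \<forall>x\<in>coords \<kappa>. \<forall>a b c. cov_bivector (\<Gamma> \<kappa>) (\<epsilon> \<kappa>) a b c x = 0"
    and "schouten A \<Gamma> P"
    and "\<exists>\<Gamma>' g. pseudo_riemannian A g \<and> levi_civita A g \<Gamma>' \<and> projectively_equivalent A \<Gamma> \<Gamma>'"
  shows "\<forall>\<kappa>\<in>A. \<forall>x\<in>coords \<kappa>. obstruction (\<Gamma> \<kappa>) (\<epsilon> \<kappa>) (P \<kappa>) x = 0"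
proof (intro ballI)
  fix \<kappa> x assume \<kappa>: "\<kappa> \<in> A" and x: "x \<in> coords \<kappa>"
  obtain \<Gamma>' g \<omega> where g: "pseudo_riemannian A g" and \<Gamma>': "levi_civita A g \<Gamma>'"
    and \<omega>: "one_form A \<omega>"
    and eq: "\<And>x a b c. x \<in> coords \<kappa> \<Longrightarrow>
      \<Gamma>' \<kappa> c a b x = \<Gamma> \<kappa> c a b x + kdelta c a * \<omega> \<kappa> b x + kdelta c b * \<omega> \<kappa> a x"
    using assms(7) \<kappa> unfolding projectively_equivalent_def by metis
  have skew: "\<epsilon> \<kappa> a b x = - \<epsilon> \<kappa> b a x" and nz: "\<exists>a b. \<epsilon> \<kappa> a b x \<noteq> 0" if "x \<in> coords \<kappa>" for x a b
    using assms(4) \<kappa> that unfolding volume_bivector_def by blast+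
  interpret special_connection "coords \<kappa>" "\<Gamma> \<kappa>" "\<epsilon> \<kappa>"
  proof
    show "open (coords \<kappa>)" using assms(1) \<kappa> by (auto simp: smooth_surface_def)
    show "\<epsilon> \<kappa> 1 2 x \<noteq> 0" if y: "x \<in> coords \<kappa>" for x
    proof -
      obtain a b where "\<epsilon> \<kappa> a b x \<noteq> 0" using nz[OF y] by blast
      thus ?thesis
        using skew[OF y, of 1 1] skew[OF y, of 2 2] skew[OF y, of 2 1] exhaust_2[of a] exhaust_2[of b]
        by auto
    qed
    show "smooth_on (coords \<kappa>) (\<Gamma> \<kappa> c a b)" for c a b
      using assms(2) \<kappa> by (simp add: affine_connection_def)
    show "smooth_on (coords \<kappa>) (\<epsilon> \<kappa> a b)" for a b
      using assms(4) \<kappa> by (simp add: volume_bivector_def contravariant2_def)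
    show "\<Gamma> \<kappa> c a b x = \<Gamma> \<kappa> c b a x" if "x \<in> coords \<kappa>" for x c a b
      using assms(3) \<kappa> that unfolding torsion_free_def by blast
    show "\<epsilon> \<kappa> a b x = - \<epsilon> \<kappa> b a x" if "x \<in> coords \<kappa>" for x a b
      by (rule skew[OF that])
    show "cov_bivector (\<Gamma> \<kappa>) (\<epsilon> \<kappa>) a b c x = 0" if "x \<in> coords \<kappa>" for x a b c
      using assms(5) \<kappa> that by blast
  qed
  interpret schouten_connection "coords \<kappa>" "\<Gamma> \<kappa>" "\<epsilon> \<kappa>" "P \<kappa>"
    by unfold_locales (use assms(6) \<kappa> in \<open>simp add: schouten_def\<close>)
  have g': "smooth_on (coords \<kappa>) (g \<kappa> a b)" for a b
    using g \<kappa> by (auto simp: pseudo_riemannian_def covariant2_def)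
  have \<omega>': "smooth_on (coords \<kappa>) (\<omega> \<kappa> a)" for a
    using \<omega> \<kappa> by (auto simp: one_form_def)
  have g_sym: "g \<kappa> a b x = g \<kappa> b a x" if "x \<in> coords \<kappa>" for a b x
    using g \<kappa> that unfolding pseudo_riemannian_def by blast
  have g_det: "g \<kappa> 1 1 x * g \<kappa> 2 2 x - g \<kappa> 1 2 x * g \<kappa> 1 2 x \<noteq> 0" if "x \<in> coords \<kappa>" for x
  proof -
    have "det (\<chi> a b. g \<kappa> a b x) \<noteq> 0" using g \<kappa> that by (simp add: pseudo_riemannian_def)
    thus ?thesis by (simp add: det_2 g_sym[OF that, of 2 1])
  qed
  have cov_g: "cov2 (\<lambda>c a b x. \<Gamma> \<kappa> c a b x + kdelta c a * \<omega> \<kappa> b x + kdelta c b * \<omega> \<kappa> a x) (g \<kappa>) a b c x = 0"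
    if "x \<in> coords \<kappa>" for x a b c
  proof -
    have "cov2 (\<Gamma>' \<kappa>) (g \<kappa>) a b c x = 0"
      using \<Gamma>' \<kappa> that unfolding levi_civita_def by blast
    \<comment> \<open>\<open>cov2\<close> contains the symbols undifferentiated, so their equality
      at the point suffices.\<close>
    thus ?thesis by (simp add: cov2_def eq[OF that])
  qed
  obtain \<sigma> \<mu> where \<sigma>: "\<forall>a b. smooth_on (coords \<kappa>) (\<sigma> a b)" "\<forall>a. smooth_on (coords \<kappa>) (\<mu> a)"
    "\<forall>x\<in>coords \<kappa>. \<forall>a b. \<sigma> a b x = \<sigma> b a x"
    "\<forall>x\<in>coords \<kappa>. \<forall>a b c. cov_bivector (\<Gamma> \<kappa>) \<sigma> a b c x = kdelta b a * \<mu> c x + kdelta c a * \<mu> b x"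
    and nz: "\<forall>x\<in>coords \<kappa>. \<sigma> 1 1 x \<noteq> 0 \<or> \<sigma> 1 2 x \<noteq> 0"
    using ex_metrisability_solution[OF g' \<omega>' g_sym g_det cov_g] by blast
  interpret metrisability_solution "coords \<kappa>" "\<Gamma> \<kappa>" "\<epsilon> \<kappa>" "P \<kappa>" \<sigma> \<mu>
    by unfold_locales (use \<sigma> in blast)+
  show "obstruction (\<Gamma> \<kappa>) (\<epsilon> \<kappa>) (P \<kappa>) x = 0"
    using obstruction_eq_0[OF x] nz x by blast
qed

end
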